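(* Let $(\Omega,d,\mu)$ be a metric measure space, let $Q>0$, $0<\alpha\le1$, and let $X$ be an r.i. space on $\Omega$ satisfying $\overline\alpha_X<1$. Then the following assertions are equivalent. (i) There is a constant $C>0$ such that for every $f\in M^{\alpha,X}$, $$\left\|t^{-\alpha/Q}\,O(f,t)\right\|_X\le C\,\|f\|_{\dot M^{\alpha,X}} .$$ (ii) There is a constant $c>0$ such that $$h_\mu(r):=\inf_{x\in\Omega}\mu(B(x,r))\ge c\,r^Q,\qquad r>0 .$$
   Context: Metric measure space: $(\Omega,d)$ is a separable metric space, $\mu$ is a nonatomic Borel measure on $\Omega$ (in particular $\mu(\{x\})=0$ for all $x$) with $\mu(\Omega)=\infty$ and $0<\mu(B)<\infty$ for every open ball $B=B(x,r)=\{y:d(x,y)<r\}$. Rearrangements: for measurable $f$, $f^*(t)=\inf\{\lambda\ge0:\mu\{|f|>\lambda\}\le t\}$, $f^{**}(t)=\frac1t\int_0^tf^*(s)\,ds$, $O(f,t)=f^{**}(t)-f^*(t)$. R.i. space: a Banach space $X$ of ($\mu$-a.e. classes of) measurable functions with the lattice property ($|f|\le|g|$, $g\in X$ imply $f\in X$, $\|f\|_X\le\|g\|_X$), the Fatou property ($0\le f_n\uparrow f$ a.e. implies $\|f_n\|_X\uparrow\|f\|_X$), and rearrangement invariance ($f^*=g^*$, $f\in X$ imply $g\in X$, $\|g\|_X=\|f\|_X$); one has $L^1\cap L^\infty\subset X\subset L^1+L^\infty$ continuously. $X$ has a representation space $\overline X$ on $(0,\infty)$ with Lebesgue measure, with $\|f\|_X=\|f^*\|_{\overline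 X}$; for a function $F$ of $t\in(0,\infty)$, $\|F(t)\|_X$ means $\|F\|_{\overline X}$. Upper Boyd index: $\overline\alpha_X=\inf_{s>1}\frac{\log h_X(s)}{\log s}$, where $h_X(s)$ is the operator norm on $\overline X$ of $E_sF(t)=F(t/s)$. Haj\l asz spaces: $D^\alpha(f)$ is the set of nonnegative measurable $g$ with $|f(x)-f(y)|\le d(x,y)^\alpha(g(x)+g(y))$ for $\mu$-a.e. $x,y$; $\|f\|_{\dot M^{\alpha,X}}=\inf_{g\in D^\alpha(f)}\|g\|_X$; $M^{\alpha,X}$ is the set of $f\in X$ with $\|f\|_{\dot M^{\alpha,X}}<\infty$. *)

theory Defs
  imports "HOL-Analysis.Analysis" "HOL-Probability.Essential_Supremum"
begin

definition nonatomic :: "'a measure \<Rightarrow> bool" where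
  "nonatomic M \<longleftrightarrow> (\<forall>A\<in>sets M. 0 < emeasure M A \<longrightarrow>
     (\<exists>B\<in>sets M. B \<subseteq> A \<and> 0 < emeasure M B \<and> emeasure M B < emeasure M A))"

locale metric_measure_space =
  fixes M :: "'a::metric_space measure"
  assumes separable: "separable_space (euclidean :: 'a topology)"
    and sets_eq_borel: "sets M = sets borel"
    and nonatomic: "nonatomic M"
    and infinite_measure: "emeasure M (space M) = \<infinity>"
    and ball_pos: "\<And>x r. 0 < r \<Longrightarrow> 0 < emeasure M (ball x r)"
    and ball_finite: "\<And>x r. emeasure M (ball x r) < \<infinity>"

definition h_mu :: "'a::metric_space measure \<Rightarrow> real \<Rightarrow> ennreal" where
  "h_mu M r = (INF x\<in>space M. emeasure M (ball x r))"

text \<open>Extended-real valued: the infimum over the empty set is \<open>\<infinity>\<close>.\<close>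

definition rearr :: "'a measure \<Rightarrow> ('a \<Rightarrow> real) \<Rightarrow> real \<Rightarrow> ennreal" where
  "rearr M f t =
     Inf {ennreal l |l. 0 \<le> l \<and> emeasure M {x\<in>space M. l < \<bar>f x\<bar>} \<le> ennreal t}"

definition max_rearr :: "'a measure \<Rightarrow> ('a \<Rightarrow> real) \<Rightarrow> real \<Rightarrow> ennreal" where
  "max_rearr M f t = (\<integral>\<^sup>+s\<in>{0<..<t}. rearr M f s \<partial>lborel) / ennreal t"

definition rearr_osc :: "'a measure \<Rightarrow> ('a \<Rightarrow> real) \<Rightarrow> real \<Rightarrow> ennreal" where
  "rearr_osc M f t = max_rearr M f t - rearr M f t"

definition L1_norm :: "'a measure \<Rightarrow> ('a \<Rightarrow> real) \<Rightarrow> ennreal" where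
  "L1_norm M f = (\<integral>\<^sup>+x. ennreal \<bar>f x\<bar> \<partial>M)"

definition Linf_norm :: "'a measure \<Rightarrow> ('a \<Rightarrow> real) \<Rightarrow> ennreal" where
  "Linf_norm M f = esssup M (\<lambda>x. ennreal \<bar>f x\<bar>)"

definition L1_sum_Linf_norm :: "'a measure \<Rightarrow> ('a \<Rightarrow> real) \<Rightarrow> ennreal" where
  "L1_sum_Linf_norm M f =
     Inf {L1_norm M g + Linf_norm M h |g h. g \<in> borel_measurable M \<and> h \<in> borel_measurable M \<and>
       (\<forall>x\<in>space M. f x = g x + h x)}"

text \<open>
  A space \<open>X\<close> of measurable functions is given by its norm \<open>N\<close>, extended by \<open>N f = \<infinity>\<close> for
  measurable \<open>f\<close> outside \<open>X\<close>; the values of \<open>N\<close> at non-measurable functions carry no meaning.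
  Functions need not be replaced by classes, because \<open>lattice\<close> makes \<open>N\<close> invariant under
  changes on null sets.  The embedding of \<open>L\<^sup>1 \<inter> L\<^sup>\<infinity>\<close> excludes the space \<open>{0}\<close>.
\<close>

definition space_of :: "'a measure \<Rightarrow> (('a \<Rightarrow> real) \<Rightarrow> ennreal) \<Rightarrow> ('a \<Rightarrow> real) set" where
  "space_of M N = {f \<in> borel_measurable M. N f < \<infinity>}"

locale ri_space =
  fixes M :: "'a measure" and N :: "('a \<Rightarrow> real) \<Rightarrow> ennreal"
  assumes norm_zero_iff: "\<And>f. f \<in> borel_measurable M \<Longrightarrow> N f = 0 \<longleftrightarrow> (AE x in M. f x = 0)"
    and norm_scale: "\<And>f c. f \<in> borel_measurable M \<Longrightarrow> N (\<lambda>x. c * f x) = ennreal \<bar>c\<bar> * N f"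
    and norm_triangle: "\<And>f g. f \<in> borel_measurable M \<Longrightarrow> g \<in> borel_measurable M \<Longrightarrow>
          N (\<lambda>x. f x + g x) \<le> N f + N g"
    and complete: "\<And>u. (\<forall>n. u n \<in> space_of M N) \<Longrightarrow>
          (\<forall>e>0. \<exists>K::nat. \<forall>m\<ge>K. \<forall>n\<ge>K. N (\<lambda>x. u m x - u n x) < ennreal e) \<Longrightarrow>
          (\<exists>f\<in>space_of M N. (\<lambda>n. N (\<lambda>x. u n x - f x)) \<longlonglongrightarrow> 0)"
    and lattice: "\<And>f g. f \<in> borel_measurable M \<Longrightarrow> g \<in> borel_measurable M \<Longrightarrow>
          (AE x in M. \<bar>f x\<bar> \<le> \<bar>g x\<bar>) \<Longrightarrow> N f \<le> N g"
    and fatou: "\<And>u f. (\<forall>n::nat. u n \<in> borel_measurable M) \<Longrightarrow> f \<in> borel_measurable M \<Longrightarrow>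
          (AE x in M. 0 \<le> u 0 x \<and> incseq (\<lambda>n. u n x) \<and> (\<lambda>n. u n x) \<longlonglongrightarrow> f x) \<Longrightarrow>
          (\<lambda>n. N (u n)) \<longlonglongrightarrow> N f"
    and rearrangement_invariant: "\<And>f g. f \<in> borel_measurable M \<Longrightarrow> g \<in> borel_measurable M \<Longrightarrow>
          (\<forall>t>0. rearr M f t = rearr M g t) \<Longrightarrow> N f = N g"
    and L1_inter_Linf_embedding: "\<exists>C>0. \<forall>f\<in>borel_measurable M.
          N f \<le> ennreal C * max (L1_norm M f) (Linf_norm M f)"
    and L1_sum_Linf_embedding: "\<exists>C>0. \<forall>f\<in>borel_measurable M.
          L1_sum_Linf_norm M f \<le> ennreal C * N f"

text \<open>The norm \<open>N\<close> applied to a nonnegative function that may take the value \<open>\<infinity>\<close>.\<close>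

definition enorm :: "'a measure \<Rightarrow> (('a \<Rightarrow> real) \<Rightarrow> ennreal) \<Rightarrow> ('a \<Rightarrow> ennreal) \<Rightarrow> ennreal" where
  "enorm M N F = (if AE x in M. F x < \<infinity> then N (\<lambda>x. enn2real (F x)) else \<infinity>)"

abbreviation half_line :: "real measure" where
  "half_line \<equiv> lebesgue_on {0<..}"

definition is_representation ::
  "'a measure \<Rightarrow> (('a \<Rightarrow> real) \<Rightarrow> ennreal) \<Rightarrow> ((real \<Rightarrow> real) \<Rightarrow> ennreal) \<Rightarrow> bool" where
  "is_representation M N Nbar \<longleftrightarrow> ri_space half_line Nbar \<and>
     (\<forall>f\<in>borel_measurable M. N f = enorm half_line Nbar (rearr M f))"

text \<open>Operator norm of \<open>F \<mapsto> F (\<cdot> / s)\<close> on the space on the half line.\<close>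

definition dilation_norm :: "((real \<Rightarrow> real) \<Rightarrow> ennreal) \<Rightarrow> real \<Rightarrow> ennreal" where
  "dilation_norm Nbar s =
     (SUP F\<in>{F \<in> borel_measurable half_line. Nbar F \<le> 1}. Nbar (\<lambda>t. F (t / s)))"

definition upper_boyd_index :: "((real \<Rightarrow> real) \<Rightarrow> ennreal) \<Rightarrow> real" where
  "upper_boyd_index Nbar = (INF s\<in>{1<..}. ln (enn2real (dilation_norm Nbar s)) / ln s)"

text \<open>``For almost all \<open>x, y\<close>'' means for all \<open>x, y\<close> outside a null set of the space.\<close>

definition hajlasz_gradients ::
  "'a::metric_space measure \<Rightarrow> real \<Rightarrow> ('a \<Rightarrow> real) \<Rightarrow> ('a \<Rightarrow> real) set" where
  "hajlasz_gradients M \<alpha> f = {g \<in> borel_measurable M. (\<forall>x\<in>space M. 0 \<le> g x) \<and>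
     (\<exists>E\<in>null_sets M. \<forall>x\<in>space M - E. \<forall>y\<in>space M - E.
        \<bar>f x - f y\<bar> \<le> dist x y powr \<alpha> * (g x + g y))}"

definition hajlasz_seminorm ::
  "'a::metric_space measure \<Rightarrow> (('a \<Rightarrow> real) \<Rightarrow> ennreal) \<Rightarrow> real \<Rightarrow> ('a \<Rightarrow> real) \<Rightarrow> ennreal" where
  "hajlasz_seminorm M N \<alpha> f = (INF g\<in>hajlasz_gradients M \<alpha> f. N g)"

definition hajlasz_space ::
  "'a::metric_space measure \<Rightarrow> (('a \<Rightarrow> real) \<Rightarrow> ennreal) \<Rightarrow> real \<Rightarrow> ('a \<Rightarrow> real) set" where
  "hajlasz_space M N \<alpha> = {f \<in> space_of M N. hajlasz_seminorm M N \<alpha> f < \<infinity>}"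

end

theory Submission
  imports Defs
begin

text \<open>
  If \<open>h_mu M r \<ge> c * r powr Q\<close>, choose \<open>r\<close> with \<open>c * r powr Q = 3 * t\<close>.  Every ball of radius \<open>r\<close>
  then contains a point \<open>y\<close> with \<open>\<bar>f y\<bar> \<le> f\<^sup>*(t)\<close> and \<open>g y \<le> g\<^sup>*(t)\<close>, so that almost everywhere
  \<open>\<bar>f\<bar> \<le> f\<^sup>*(t) + r\<^sup>\<alpha> (g + g\<^sup>*(t))\<close>.  Rearranging and averaging gives \<open>O(f,t) \<le> 2 r\<^sup>\<alpha> g\<^sup>*\<^sup>*(t)\<close>, and
  Hardy's averaging operator is bounded because some \<open>s > 1\<close> has dilation norm less than \<open>s\<close>.

  Conversely, test the embedding with a cutoff function that is \<open>1\<close> on \<open>B(x,\<rho>)\<close> and vanishes outside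
  \<open>B(x,r)\<close>, where \<open>\<mu>(B(x,\<rho>)) \<ge> \<mu>(B(x,r)) / 2\<close>.  On \<open>(V, 2 V)\<close> with \<open>V = \<mu>(B(x,r))\<close> its oscillation
  is at least \<open>1/4\<close>, which yields \<open>r - \<rho> \<le> K V\<^sup>1\<^sup>/\<^sup>Q\<close>; summing these gaps while the measure is
  halved repeatedly bounds \<open>r\<close> itself by a multiple of \<open>V\<^sup>1\<^sup>/\<^sup>Q\<close>.
\<close>

section \<open>Rearrangements\<close>

lemma sets_half_line_iff: "S \<in> sets half_line \<longleftrightarrow> S \<subseteq> {0<..} \<and> S \<in> sets lebesgue"
  by (subst sets_restrict_space_iff) auto

lemma emeasure_half_line: "S \<subseteq> {0<..} \<Longrightarrow> emeasure half_line S = emeasure lebesgue S"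
  by (subst emeasure_restrict_space) auto

lemma borel_imp_half_line:
  fixes f :: "real \<Rightarrow> 'b::topological_space"
  shows "f \<in> borel_measurable borel \<Longrightarrow> f \<in> borel_measurable half_line"
  by (intro measurable_restrict_space1 measurable_completion) simp

section \<open>Decreasing rearrangements and their level sets\<close>

lemma rearr_cong_distribution:
  assumes "\<And>l. 0 \<le> l \<Longrightarrow>
    emeasure M {x \<in> space M. l < \<bar>f x\<bar>} = emeasure M {x \<in> space M. l < \<bar>g x\<bar>}"
  shows "rearr M f t = rearr M g t"
  unfolding rearr_def using assms by (intro arg_cong[where f=Inf] Collect_cong ex_cong1) auto

lemma rearr_antimono: "s \<le> t \<Longrightarrow> rearr M f t \<le> rearr M f s"
  unfolding rearr_def by (rule Inf_superset_mono) (auto intro: order_trans[OF _ ennreal_leI])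

lemma rearr_le:
  assumes "0 \<le> l" "emeasure M {x \<in> space M. l < \<bar>f x\<bar>} \<le> ennreal t"
  shows "rearr M f t \<le> ennreal l"
  unfolding rearr_def using assms by (intro Inf_lower) auto

lemma rearr_ge:
  assumes "\<And>l. 0 \<le> l \<Longrightarrow> l < a \<Longrightarrow> ennreal t < emeasure M {x \<in> space M. l < \<bar>f x\<bar>}"
  shows "ennreal a \<le> rearr M f t"
  unfolding rearr_def
proof (rule Inf_greatest, clarify)
  fix l :: real assume "0 \<le> l" "emeasure M {x \<in> space M. l < \<bar>f x\<bar>} \<le> ennreal t"
  with assms[of l] have "a \<le> l" by (meson not_less)
  then show "ennreal a \<le> ennreal l" by (rule ennreal_leI)
qed

text \<open>The infimum defining the rearrangement is attained: the superlevel set at the infimum is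
  the increasing union of superlevel sets at slightly higher levels, each of measure at most
  \<open>t\<close>, and the measure is continuous from below.\<close>

lemma emeasure_above_rearr_le:
  assumes [measurable]: "f \<in> borel_measurable M" and fin: "rearr M f t < \<infinity>"
  shows "emeasure M {x \<in> space M. enn2real (rearr M f t) < \<bar>f x\<bar>} \<le> ennreal t"
proof -
  define r where "r = enn2real (rearr M f t)"
  have r: "rearr M f t = ennreal r" "0 \<le> r" using fin by (auto simp: r_def)
  define A where "A n = {x \<in> space M. r + 1 / Suc n < \<bar>f x\<bar>}" for n :: nat
  have A: "emeasure M (A n) \<le> ennreal t" for n
  proof -
    have "rearr M f t < ennreal (r + 1 / Suc n)"
      unfolding r(1) using r(2) by (intro ennreal_lessI) (auto intro: add_nonneg_pos)
    then obtain l where l: "0 \<le> l" "emeasure M {x\<in>space M. l < \<bar>f x\<bar>} \<le> ennreal t"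
      "ennreal l < ennreal (r + 1 / Suc n)"
      unfolding rearr_def by (auto simp: Inf_less_iff)
    then have "l < r + 1 / Suc n" by (simp add: ennreal_less_iff)
    then have "emeasure M (A n) \<le> emeasure M {x\<in>space M. l < \<bar>f x\<bar>}"
      unfolding A_def by (intro emeasure_mono) auto
    with l show ?thesis by simp
  qed
  have "incseq A"
    unfolding A_def incseq_def
  proof (intro allI impI subsetI CollectI conjI; clarify)
    fix m n :: nat and x assume "m \<le> n" and x: "r + 1 / Suc m < \<bar>f x\<bar>"
    then have "1 / real (Suc n) \<le> 1 / real (Suc m)" by (intro divide_left_mono) auto
    with x show "r + 1 / Suc n < \<bar>f x\<bar>" by linarith
  qed
  moreover have "range A \<subseteq> sets M" unfolding A_def by auto
  ultimately have "(SUP n. emeasure M (A n)) = emeasure M (\<Union>n. A n)"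
    by (intro SUP_emeasure_incseq) auto
  moreover have "(\<Union>n. A n) = {x \<in> space M. r < \<bar>f x\<bar>}"
  proof (intro set_eqI iffI)
    fix x assume "x \<in> {x \<in> space M. r < \<bar>f x\<bar>}"
    then have x: "x \<in> space M" "0 < \<bar>f x\<bar> - r" by auto
    obtain n where "1 / Suc n < \<bar>f x\<bar> - r" using reals_Archimedean[OF x(2)]
      by (auto simp: inverse_eq_divide)
    with x show "x \<in> (\<Union>n. A n)" by (auto simp: A_def intro!: exI[of _ n])
  next
    fix x assume "x \<in> (\<Union>n. A n)"
    then obtain n where n: "x \<in> space M" "r + 1 / Suc n < \<bar>f x\<bar>" by (auto simp: A_def)
    have "0 < 1 / real (Suc n)" by simp
    with n have "r < \<bar>f x\<bar>" by linarith
    with n show "x \<in> {x \<in> space M. r < \<bar>f x\<bar>}" by simp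
  qed
  ultimately have "emeasure M {x \<in> space M. r < \<bar>f x\<bar>} = (SUP n. emeasure M (A n))" by simp
  also have "\<dots> \<le> ennreal t" using A by (intro SUP_least)
  finally show ?thesis unfolding r_def .
qed

section \<open>Measurability and finiteness of rearrangements and averages\<close>

text \<open>Superlevel sets of monotone functions on the line are intervals, hence Borel.\<close>

lemma borel_measurable_monotone:
  fixes f :: "real \<Rightarrow> ennreal"
  shows "mono f \<Longrightarrow> f \<in> borel_measurable borel" "antimono f \<Longrightarrow> f \<in> borel_measurable borel"
proof -
  assume f: "mono f"
  have "is_interval {x. y < f x}" for y
    unfolding is_interval_1 mem_Collect_eq using f by (blast intro: order.strict_trans2 monoD)
  then show "f \<in> borel_measurable borel"
    by (intro borel_measurableI_greater) (auto intro: real_interval_borel_measurable)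
next
  assume f: "antimono f"
  have "is_interval {x. y < f x}" for y
    unfolding is_interval_1 mem_Collect_eq using f by (blast intro: order.strict_trans2 antimonoD)
  then show "f \<in> borel_measurable borel"
    by (intro borel_measurableI_greater) (auto intro: real_interval_borel_measurable)
qed

lemma rearr_measurable [measurable]: "rearr M f \<in> borel_measurable borel"
  by (rule borel_measurable_monotone(2)) (auto simp: antimono_def rearr_antimono)

text \<open>The numerator is monotone in the endpoint \<open>t\<close>, so
  \<open>borel_measurable_monotone\<close> applies to it.\<close>

lemma average_measurable:
  "(\<lambda>t. (\<integral>\<^sup>+x\<in>{0<..<t}. R x \<partial>lborel) / ennreal t) \<in> borel_measurable borel"
proof -
  have [measurable]: "(\<lambda>t. \<integral>\<^sup>+x\<in>{0<..<t}. R x \<partial>lborel) \<in> borel_measurable borel"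
    by (rule borel_measurable_monotone(1))
      (auto simp: mono_def intro!: nn_integral_mono split: split_indicator)
  show ?thesis by measurable
qed

lemma max_rearr_measurable [measurable]: "max_rearr M f \<in> borel_measurable borel"
  unfolding max_rearr_def[abs_def] by (rule average_measurable)

lemma rearr_osc_measurable [measurable]: "rearr_osc M f \<in> borel_measurable borel"
  unfolding rearr_osc_def[abs_def] by measurable

lemma enorm_finiteD: "enorm M N F < \<infinity> \<Longrightarrow> AE x in M. F x < \<infinity>"
  by (auto simp: enorm_def split: if_splits)

text \<open>An initial interval has positive measure and so cannot lie inside a null set. For
  decreasing functions this turns finiteness almost everywhere into finiteness at every
  \<open>t > 0\<close>.\<close>

lemma AE_half_line_exists:
  assumes "AE x in half_line. P x" "0 < t"
  shows "\<exists>s. 0 < s \<and> s < t \<and> P s"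
proof (rule ccontr)
  assume *: "\<not> ?thesis"
  from assms(1) obtain Z where Z: "{x\<in>{0<..}. \<not> P x} \<subseteq> Z" "Z \<in> null_sets half_line"
    by (auto elim!: AE_E simp: null_sets_def)
  have "{0<..<t} \<subseteq> Z" using * Z(1) by force
  moreover have "{0<..<t} \<in> sets half_line" by (subst sets_half_line_iff) auto
  ultimately have "emeasure half_line {0<..<t} = 0"
    using Z(2) by (meson null_sets_subset null_setsD1)
  moreover have "emeasure half_line {0<..<t} = ennreal t"
    using assms(2) by (subst emeasure_half_line) (auto)
  ultimately show False using assms(2) by simp
qed

lemma rearr_finite:
  assumes "enorm half_line N (rearr M f) < \<infinity>" "0 < t"
  shows "rearr M f t < \<infinity>"
proof -
  obtain s where "0 < s" "s < t" "rearr M f s < \<infinity>"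
    using AE_half_line_exists[OF enorm_finiteD[OF assms(1)] assms(2)] by blast
  then show ?thesis using rearr_antimono[of s t M f] by simp
qed

lemma enorm_mono:
  assumes "ri_space M N" "F \<in> borel_measurable M" "G \<in> borel_measurable M"
    and le: "AE x in M. F x \<le> G x"
  shows "enorm M N F \<le> enorm M N G"
proof (cases "AE x in M. G x < \<infinity>")
  case True
  have "AE x in M. F x < \<infinity>" using le True by eventually_elim auto
  moreover have "N (\<lambda>x. enn2real (F x)) \<le> N (\<lambda>x. enn2real (G x))"
  proof (rule ri_space.lattice[OF assms(1)])
    show "AE x in M. \<bar>enn2real (F x)\<bar> \<le> \<bar>enn2real (G x)\<bar>"
      using le True by eventually_elim (auto intro: enn2real_mono)
  qed (use assms in measurable)
  ultimately show ?thesis using True by (simp add: enorm_def)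
qed (simp add: enorm_def)

section \<open>Rearrangement-invariant norms\<close>

context ri_space
begin

lemma norm_minus_commute:
  assumes [measurable]: "f \<in> borel_measurable M" "g \<in> borel_measurable M"
  shows "N (\<lambda>x. f x - g x) = N (\<lambda>x. g x - f x)"
  by (intro antisym lattice) auto

lemma norm_eq_distribution:
  assumes "f \<in> borel_measurable M" "g \<in> borel_measurable M"
    and "\<And>l. 0 \<le> l \<Longrightarrow>
      emeasure M {x \<in> space M. l < \<bar>f x\<bar>} = emeasure M {x \<in> space M. l < \<bar>g x\<bar>}"
  shows "N f = N g"
  using assms by (intro rearrangement_invariant) (auto intro: rearr_cong_distribution)

lemma norm_zero: "N (\<lambda>x. 0) = 0"
  by (subst norm_zero_iff) auto

lemma norm_sum_le:
  assumes "\<And>k. u k \<in> borel_measurable M"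
  shows "finite K \<Longrightarrow> N (\<lambda>x. \<Sum>k\<in>K. u k x) \<le> (\<Sum>k\<in>K. N (u k))"
proof (induction K rule: finite_induct)
  case (insert k K)
  have "N (\<lambda>x. u k x + (\<Sum>k\<in>K. u k x)) \<le> N (u k) + N (\<lambda>x. \<Sum>k\<in>K. u k x)"
    using assms by (intro norm_triangle) auto
  also have "\<dots> \<le> N (u k) + (\<Sum>k\<in>K. N (u k))" using insert by (intro add_left_mono)
  finally show ?case using insert by simp
qed (simp add: norm_zero)

text \<open>Completeness, rather than the Fatou property, is used here because the series is not
  known in advance to be finite almost everywhere.\<close>

lemma countable_subadditive:
  fixes u :: "nat \<Rightarrow> 'a \<Rightarrow> real"
  assumes u [measurable]: "\<And>k. u k \<in> borel_measurable M"
    and nonneg: "\<And>k x. x \<in> space M \<Longrightarrow> 0 \<le> u k x"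
    and fin: "(\<Sum>k. N (u k)) < \<infinity>"
  shows "\<exists>f\<in>borel_measurable M. N f \<le> (\<Sum>k. N (u k)) \<and> (AE x in M. \<forall>n. (\<Sum>k<n. u k x) \<le> f x)"
proof -
  define S where "S n x = (\<Sum>k<n. u k x)" for n x
  have [measurable]: "S n \<in> borel_measurable M" for n unfolding S_def[abs_def] by measurable
  define a where "a k = enn2real (N (u k))" for k
  have uk: "N (u k) < \<infinity>" for k
    using ennreal_suminf_lessD[of "\<lambda>k. N (u k)" \<infinity> k] fin by simp
  then have a: "N (u k) = ennreal (a k)" for k unfolding a_def by simp
  have a0: "0 \<le> a k" for k by (simp add: a_def)
  have sa: "summable a"
    using fin unfolding a by (intro summable_suminf_not_top a0) auto
  have diff: "N (\<lambda>x. S n x - S m x) \<le> ennreal (sum a {m..<n})" if "m \<le> n" for m n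
  proof -
    have "(\<lambda>x. S n x - S m x) = (\<lambda>x. \<Sum>k\<in>{m..<n}. u k x)"
      using that by (auto simp: S_def sum_diff_nat_ivl lessThan_atLeast0)
    then have "N (\<lambda>x. S n x - S m x) \<le> (\<Sum>k\<in>{m..<n}. N (u k))"
      using norm_sum_le[OF u, of "{m..<n}"] by simp
    then show ?thesis by (simp add: a a0 sum_ennreal)
  qed
  have Sle: "N (S n) \<le> (\<Sum>k. N (u k))" for n
  proof -
    have "N (S n) \<le> (\<Sum>k<n. N (u k))" unfolding S_def[abs_def] by (intro norm_sum_le) auto
    also have "\<dots> \<le> (\<Sum>k. N (u k))" by (intro sum_le_suminf) auto
    finally show ?thesis .
  qed
  have "\<exists>f\<in>space_of M N. (\<lambda>n. N (\<lambda>x. S n x - f x)) \<longlonglongrightarrow> 0"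
  proof (rule complete)
    show "\<forall>n. S n \<in> space_of M N"
      using le_less_trans[OF Sle fin] by (simp add: space_of_def)
    show "\<forall>e>0. \<exists>K. \<forall>m\<ge>K. \<forall>n\<ge>K. N (\<lambda>x. S m x - S n x) < ennreal e"
    proof (intro allI impI)
      fix e :: real assume e: "0 < e"
      obtain K where K: "\<And>m n. m \<ge> K \<Longrightarrow> norm (sum a {m..<n}) < e"
        using sa e unfolding summable_Cauchy by metis
      have *: "N (\<lambda>x. S n x - S m x) < ennreal e" if "K \<le> m" "m \<le> n" for m n
        using diff[OF that(2)] K[OF that(1), of n] e
        by (intro le_less_trans[OF diff[OF that(2)]] ennreal_lessI) auto
      show "\<exists>K. \<forall>m\<ge>K. \<forall>n\<ge>K. N (\<lambda>x. S m x - S n x) < ennreal e"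
      proof (intro exI[of _ K] allI impI)
        fix m n assume "K \<le> m" "K \<le> n"
        then show "N (\<lambda>x. S m x - S n x) < ennreal e"
          using *[of m n] *[of n m] norm_minus_commute[of "S m" "S n"] by (cases "m \<le> n") auto
      qed
    qed
  qed
  then obtain f where f: "f \<in> space_of M N" and lim: "(\<lambda>n. N (\<lambda>x. S n x - f x)) \<longlonglongrightarrow> 0" by blast
  have [measurable]: "f \<in> borel_measurable M" using f by (simp add: space_of_def)
  have "AE x in M. S n x \<le> f x" for n
  proof -
    \<comment> \<open>The partial sums increase, so the positive part of \<open>S n - f\<close> is
      dominated by \<open>S m - f\<close> in absolute value for every later \<open>m\<close>; these
      norms tend to zero.\<close>
    have "N (\<lambda>x. max 0 (S n x - f x)) \<le> N (\<lambda>x. S m x - f x)" if "n \<le> m" for m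
    proof (rule lattice)
      have "S n x \<le> S m x" if "x \<in> space M" for x
        unfolding S_def using \<open>n \<le> m\<close> nonneg that by (intro sum_mono2) auto
      then show "AE x in M. \<bar>max 0 (S n x - f x)\<bar> \<le> \<bar>S m x - f x\<bar>" by (intro AE_I2) force
    qed auto
    then have "N (\<lambda>x. max 0 (S n x - f x)) \<le> 0"
      by (intro tendsto_lowerbound[OF lim]) (auto simp: eventually_sequentially)
    then have "AE x in M. max 0 (S n x - f x) = 0" by (subst norm_zero_iff[symmetric]) auto
    then show ?thesis by eventually_elim auto
  qed
  then have "AE x in M. \<forall>n. (\<Sum>k<n. u k x) \<le> f x" unfolding S_def by (simp add: AE_all_countable)
  moreover have "N f \<le> (\<Sum>k. N (u k))"
  proof -
    have "N f \<le> (\<Sum>k. N (u k)) + N (\<lambda>x. S n x - f x)" for n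
    proof -
      have "N f = N (\<lambda>x. S n x + (f x - S n x))" by simp
      also have "\<dots> \<le> N (S n) + N (\<lambda>x. f x - S n x)" by (intro norm_triangle) auto
      also have "\<dots> \<le> (\<Sum>k. N (u k)) + N (\<lambda>x. S n x - f x)"
        by (subst norm_minus_commute) (auto intro: add_right_mono Sle)
      finally show ?thesis .
    qed
    moreover have "(\<lambda>n. (\<Sum>k. N (u k)) + N (\<lambda>x. S n x - f x)) \<longlonglongrightarrow> (\<Sum>k. N (u k)) + 0"
      by (intro tendsto_add tendsto_const lim)
    ultimately have "N f \<le> (\<Sum>k. N (u k)) + 0" by (intro LIMSEQ_le_const[where x="(\<Sum>k. N (u k)) + 0"]) auto
    then show ?thesis by simp
  qed
  ultimately show ?thesis by (intro bexI[of _ f] conjI) auto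
qed

text \<open>Such an indicator is both integrable and bounded, so the embedding of the intersection
  of these two spaces bounds its norm.\<close>

lemma norm_indicator_finite:
  assumes [measurable]: "A \<in> sets M" and "emeasure M A < \<infinity>"
  shows "N (indicator A) < \<infinity>"
proof -
  obtain C where C: "C > 0" "\<And>f. f \<in> borel_measurable M \<Longrightarrow>
      N f \<le> ennreal C * max (L1_norm M f) (Linf_norm M f)"
    using L1_inter_Linf_embedding by blast
  have "L1_norm M (indicator A) = emeasure M A"
  proof -
    have "ennreal \<bar>indicator A x\<bar> = indicator A x" for x by (simp add: indicator_def)
    then show ?thesis unfolding L1_norm_def by simp
  qed
  moreover have "Linf_norm M (indicator A) \<le> 1"
    unfolding Linf_norm_def by (intro esssup_I) (auto simp: indicator_def)
  ultimately have "max (L1_norm M (indicator A)) (Linf_norm M (indicator A)) < \<infinity>"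
    using assms(2) by (auto intro: le_less_trans[of _ 1])
  then have "ennreal C * max (L1_norm M (indicator A)) (Linf_norm M (indicator A)) < \<infinity>"
    by (simp add: ennreal_mult_less_top)
  with C(2)[of "indicator A"] show ?thesis by (auto intro: le_less_trans)
qed

lemma norm_indicator_pos:
  assumes [measurable]: "A \<in> sets M" and "0 < emeasure M A"
  shows "0 < N (indicator A)"
proof (rule ccontr)
  assume "\<not> ?thesis"
  then have "AE x in M. (indicator A x :: real) = 0" by (subst norm_zero_iff[symmetric]) auto
  then have "AE x in M. x \<notin> A" by eventually_elim (auto simp: indicator_def split: if_splits)
  then have "emeasure M {x\<in>space M. x \<in> A} = 0" by (intro emeasure_eq_0_AE)
  moreover have "{x\<in>space M. x \<in> A} = A" using sets.sets_into_space[OF assms(1)] by auto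
  ultimately show False using assms by simp
qed

end

section \<open>Dilations and averages on the half line\<close>

text \<open>The image is rewritten as the preimage under the inverse affine map, which is Lebesgue
  measurable.\<close>

lemma lebesgue_affine_image:
  fixes p d :: real
  assumes "S \<in> sets lebesgue" "0 < p"
  shows "(\<lambda>x. p * x + d) ` S \<in> sets lebesgue"
    and "emeasure lebesgue ((\<lambda>x. p * x + d) ` S) = ennreal p * emeasure lebesgue S"
proof -
  have "(\<lambda>x. - d / p + 1 / p * x) \<in> lebesgue \<rightarrow>\<^sub>M lebesgue"
    using lebesgue_affine_measurable[where c="\<lambda>_::real. 1 / p" and t="- d / p"] assms(2) by simp
  from measurable_sets[OF this assms(1)]
  have "(\<lambda>x. - d / p + 1 / p * x) -` S \<in> sets lebesgue" by simp
  moreover have "(\<lambda>x. - d / p + 1 / p * x) -` S = (\<lambda>x. p * x + d) ` S"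
  proof (intro set_eqI iffI)
    fix x assume "x \<in> (\<lambda>x. - d / p + 1 / p * x) -` S"
    then show "x \<in> (\<lambda>x. p * x + d) ` S"
      using assms(2) by (intro image_eqI[where x="- d / p + 1 / p * x"]) (auto simp: field_simps)
  qed (use assms(2) in \<open>auto simp: field_simps\<close>)
  ultimately show "(\<lambda>x. p * x + d) ` S \<in> sets lebesgue" by simp
  show "emeasure lebesgue ((\<lambda>x. p * x + d) ` S) = ennreal p * emeasure lebesgue S"
    using emeasure_lebesgue_affine[of p d S] assms(2) by simp
qed

lemma half_line_level:
  fixes F :: "real \<Rightarrow> real"
  assumes "F \<in> borel_measurable half_line"
  shows "{x. 0 < x \<and> c < F x} \<in> sets lebesgue" "{x. 0 < x \<and> c < \<bar>F x\<bar> } \<in> sets lebesgue"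
proof -
  have "{x \<in> space half_line. c < F x} \<in> sets half_line"
    "{x \<in> space half_line. c < \<bar>F x\<bar>} \<in> sets half_line"
    using assms borel_measurable_abs[OF assms] unfolding borel_measurable_iff_greater by blast+
  then show "{x. 0 < x \<and> c < F x} \<in> sets lebesgue" "{x. 0 < x \<and> c < \<bar>F x\<bar> } \<in> sets lebesgue"
    by (auto simp: sets_half_line_iff)
qed

lemma half_line_measurableI:
  fixes F :: "real \<Rightarrow> real"
  assumes "\<And>c. {x. 0 < x \<and> c < F x} \<in> sets lebesgue"
  shows "F \<in> borel_measurable half_line"
  unfolding borel_measurable_iff_greater using assms by (auto simp: sets_half_line_iff)

text \<open>The summand \<open>0\<close> is kept so that the right side is literally an affine image
  in the sense of \<open>lebesgue_affine_image\<close>.\<close>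

lemma dilation_level:
  fixes s :: real
  assumes "0 < s"
  shows "{t. 0 < t \<and> P (t / s)} = (\<lambda>x. s * x + 0) ` {x. 0 < x \<and> P x}"
proof (intro set_eqI iffI)
  fix t assume "t \<in> {t. 0 < t \<and> P (t / s)}"
  then show "t \<in> (\<lambda>x. s * x + 0) ` {x. 0 < x \<and> P x}"
    using assms by (intro image_eqI[where x="t / s"]) auto
qed (use assms in auto)

lemma dilation_measurable:
  fixes s :: real
  assumes "0 < s" "F \<in> borel_measurable half_line"
  shows "(\<lambda>t. F (t / s) :: real) \<in> borel_measurable half_line"
  using assms by (intro half_line_measurableI)
    (auto simp: dilation_level[of s "\<lambda>x. _ < F x"] intro: lebesgue_affine_image half_line_level simp del: add_0_right)

lemma emeasure_dilation_level:
  fixes F :: "real \<Rightarrow> real" and s :: real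
  assumes "0 < s" "F \<in> borel_measurable half_line"
  shows "emeasure lebesgue {t. 0 < t \<and> l < \<bar>F (t / s)\<bar>} =
    ennreal s * emeasure lebesgue {x. 0 < x \<and> l < \<bar>F x\<bar>}"
  unfolding dilation_level[OF assms(1), of "\<lambda>x. l < \<bar>F x\<bar>"]
  by (intro lebesgue_affine_image half_line_level assms)

text \<open>For \<open>a + p \<le> 2\<close> the function \<open>patch a p F\<close> is a copy of \<open>F\<close>, stretched by the
  factor \<open>p\<close>, that lives on the intervals \<open>(2 * k + a, 2 * k + a + p]\<close>: the \<open>k\<close>-th of them carries
  the values of \<open>F\<close> on \<open>(k, k + 1]\<close>.  Copies on disjoint families of intervals have disjoint
  supports, which is what makes dilations comparable with sums of equimeasurable functions.\<close>

definition patch_index :: "real \<Rightarrow> real" where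
  "patch_index t = of_int (\<lceil>t / 2\<rceil> - 1)"

definition patch_dom :: "real \<Rightarrow> real \<Rightarrow> real set" where
  "patch_dom a p = {t. 0 < t \<and> a < t - 2 * patch_index t \<and> t - 2 * patch_index t \<le> a + p}"

definition patch_arg :: "real \<Rightarrow> real \<Rightarrow> real \<Rightarrow> real" where
  "patch_arg a p t = patch_index t + (t - 2 * patch_index t - a) / p"

definition patch :: "real \<Rightarrow> real \<Rightarrow> (real \<Rightarrow> real) \<Rightarrow> real \<Rightarrow> real" where
  "patch a p F t = (if t \<in> patch_dom a p then F (patch_arg a p t) else 0)"

text \<open>On the block with index \<open>k\<close> the map \<open>patch_arg a p\<close> inverts
  the displayed affine map, which carries the interval from \<open>k\<close> to \<open>k + 1\<close>
  onto the one from \<open>2 * k + a\<close> to \<open>2 * k + a + p\<close>.\<close>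

lemma patch_preimage:
  assumes "0 \<le> a" "0 < p" "a + p \<le> 2"
  shows "{t \<in> patch_dom a p. patch_arg a p t \<in> B} =
    (\<Union>k::nat. (\<lambda>x. p * x + (2 * real k + a - p * real k)) ` (B \<inter> {real k<..real k + 1}))"
    (is "?L = ?R")
proof (intro set_eqI iffI)
  fix t assume t: "t \<in> ?L"
  define k where "k = nat (\<lceil>t / 2\<rceil> - 1)"
  have "0 < \<lceil>t / 2\<rceil>" using t by (auto simp: patch_dom_def)
  then have k: "patch_index t = real k" by (simp add: k_def patch_index_def)
  show "t \<in> ?R"
    using t assms by (intro UN_I[of k] image_eqI[where x="patch_arg a p t"])
      (auto simp: patch_arg_def patch_dom_def k field_simps)
next
  fix t assume "t \<in> ?R"
  then obtain k :: nat and x where x: "x \<in> B" "real k < x" "x \<le> real k + 1"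
    and t: "t = p * x + (2 * real k + a - p * real k)" by auto
  have t': "t = p * (x - real k) + 2 * real k + a" by (simp add: t algebra_simps)
  have u: "0 < p * (x - real k)" "p * (x - real k) \<le> p" using x assms by (auto intro: mult_left_le)
  define v where "v = p * (x - real k)"
  have v: "0 < v" "v \<le> p" "t = v + 2 * real k + a" "v / p = x - real k"
    using u t' assms by (auto simp: v_def)
  \<comment> \<open>Since \<open>0 < v + a\<close> and \<open>v + a \<le> 2\<close>, the point
    \<open>t / 2\<close> lies above \<open>k\<close> and at most at \<open>k + 1\<close>; the
    ceiling matches the closed right end.\<close>
  have "\<lceil>t / 2\<rceil> = int k + 1"
    using v assms by (intro ceiling_unique) auto
  then have k: "patch_index t = real k" by (simp add: patch_index_def)
  have "patch_arg a p t = x" unfolding patch_arg_def k by (simp add: v(3,4))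
  moreover have "t \<in> patch_dom a p"
    unfolding patch_dom_def mem_Collect_eq k using v assms by simp
  ultimately show "t \<in> ?L" using x by simp
qed

text \<open>The preimage splits into disjoint affine images \<open>J k\<close> of the pieces
  \<open>I k\<close> of \<open>B\<close>. Each is stretched by \<open>p\<close>, and countable
  additivity reassembles the positive part of \<open>B\<close>.\<close>

lemma patch_preimage_measure:
  assumes "0 \<le> a" "0 < p" "a + p \<le> 2" and B: "B \<in> sets lebesgue"
  shows "{t \<in> patch_dom a p. patch_arg a p t \<in> B} \<in> sets lebesgue"
    and "emeasure lebesgue {t \<in> patch_dom a p. patch_arg a p t \<in> B} =
      ennreal p * emeasure lebesgue (B \<inter> {0<..})"
proof -
  define I where "I k = B \<inter> {real k<..real k + 1}" for k
  define J where "J k = (\<lambda>x. p * x + (2 * real k + a - p * real k)) ` I k" for k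
  have eq: "{t \<in> patch_dom a p. patch_arg a p t \<in> B} = (\<Union>k. J k)"
    unfolding J_def I_def by (rule patch_preimage[OF assms(1-3)])
  have I: "I k \<in> sets lebesgue" for k
    unfolding I_def using B by (intro sets.Int) auto
  have J: "J k \<in> sets lebesgue" "emeasure lebesgue (J k) = ennreal p * emeasure lebesgue (I k)" for k
    unfolding J_def by (intro lebesgue_affine_image I assms)+
  show "{t \<in> patch_dom a p. patch_arg a p t \<in> B} \<in> sets lebesgue"
    unfolding eq using J by auto
  have Jsub: "J k \<subseteq> {2 * real k<..2 * real k + 2}" for k
  proof
    fix t assume "t \<in> J k"
    then obtain x where x: "real k < x" "x \<le> real k + 1" and t: "t = p * (x - real k) + 2 * real k + a"
      by (auto simp: J_def I_def algebra_simps)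
    have "0 < p * (x - real k)" "p * (x - real k) \<le> p" using x assms by (auto intro: mult_left_le)
    then have "0 < p * (x - real k) + a" "p * (x - real k) + a \<le> 2" using assms by linarith+
    then show "t \<in> {2 * real k<..2 * real k + 2}" by (auto simp: t)
  qed
  have uniq: "i = j" if "2 * real i < t" "t \<le> 2 * real i + 2" "2 * real j < t" "t \<le> 2 * real j + 2"
    for i j t
  proof -
    have "real i < real (Suc j)" "real j < real (Suc i)" using that by auto
    then show ?thesis by linarith
  qed
  have dJ: "disjoint_family J"
  unfolding disjoint_family_on_def
  proof (intro ballI impI, rule ccontr)
    fix i j :: nat assume "i \<noteq> j" "J i \<inter> J j \<noteq> {}"
    then obtain t where "t \<in> J i" "t \<in> J j" by auto
    then show False using Jsub[of i] Jsub[of j] uniq[of i t j] \<open>i \<noteq> j\<close> by (auto simp: subset_eq)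
  qed
  have dI: "disjoint_family I"
  unfolding disjoint_family_on_def
  proof (intro ballI impI, rule ccontr)
    fix i j :: nat assume "i \<noteq> j" "I i \<inter> I j \<noteq> {}"
    then obtain t where "t \<in> I i" "t \<in> I j" by auto
    \<comment> \<open>Doubling turns the unit intervals into the intervals of length two handled by
      \<open>uniq\<close>.\<close>
    then show False using uniq[of i "2 * t" j] \<open>i \<noteq> j\<close> by (auto simp: I_def)
  qed
  have UI: "(\<Union>k. I k) = B \<inter> {0<..}"
  proof (intro set_eqI iffI)
    fix x assume x: "x \<in> B \<inter> {0<..}"
    define k where "k = nat (\<lceil>x\<rceil> - 1)"
    have "0 < \<lceil>x\<rceil>" using x by simp
    then have "real k = of_int \<lceil>x\<rceil> - 1" by (simp add: k_def)
    then have "real k < x" "x \<le> real k + 1" by linarith+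
    with x show "x \<in> (\<Union>k. I k)" by (auto simp: I_def)
  qed (auto simp: I_def)
  have "emeasure lebesgue (\<Union>k. J k) = (\<Sum>k. emeasure lebesgue (J k))"
    using J dJ by (intro suminf_emeasure[symmetric]) auto
  also have "\<dots> = ennreal p * (\<Sum>k. emeasure lebesgue (I k))"
    by (simp add: J)
  also have "(\<Sum>k. emeasure lebesgue (I k)) = emeasure lebesgue (\<Union>k. I k)"
    using I dI by (intro suminf_emeasure) auto
  finally show "emeasure lebesgue {t \<in> patch_dom a p. patch_arg a p t \<in> B} =
      ennreal p * emeasure lebesgue (B \<inter> {0<..})" unfolding eq UI .
qed

lemma patch_arg_pos:
  assumes "0 < p" "t \<in> patch_dom a p"
  shows "0 < t" "0 < patch_arg a p t"
proof -
  show "0 < t" using assms by (simp add: patch_dom_def)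
  then have "0 \<le> patch_index t" by (simp add: patch_index_def)
  then show "0 < patch_arg a p t" using assms
    unfolding patch_arg_def patch_dom_def by (intro add_nonneg_pos divide_pos_pos) auto
qed

lemma patch_measurable:
  assumes "0 \<le> a" "0 < p" "a + p \<le> 2" and F: "F \<in> borel_measurable half_line"
  shows "patch a p F \<in> borel_measurable half_line"
proof (rule half_line_measurableI)
  fix c
  have *: "{t \<in> patch_dom a p. patch_arg a p t \<in> {x. 0 < x \<and> c < F x}} \<in> sets lebesgue"
    by (intro patch_preimage_measure assms half_line_level)
  \<comment> \<open>The preimage of \<open>UNIV\<close> is the patch domain itself. Its complement
    in the half line joins the superlevel set for \<open>c < 0\<close>, because the patch is zero
    there.\<close>
  have **: "{0<..} - {t \<in> patch_dom a p. patch_arg a p t \<in> UNIV} \<in> sets lebesgue"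
    by (intro sets.Diff patch_preimage_measure assms) auto
  have "{t. 0 < t \<and> c < patch a p F t} =
      {t \<in> patch_dom a p. patch_arg a p t \<in> {x. 0 < x \<and> c < F x}} \<union>
      (if c < 0 then {0<..} - {t \<in> patch_dom a p. patch_arg a p t \<in> UNIV} else {})"
    using assms(2) by (auto simp: patch_def patch_arg_pos split: if_splits)
  then show "{t. 0 < t \<and> c < patch a p F t} \<in> sets lebesgue" using * ** by simp
qed

text \<open>The zero values outside the patch domain never exceed a level \<open>0 \<le> l\<close>,
  so only the preimage of the level set of \<open>F\<close> counts. In particular patches with
  \<open>p = 1\<close> are equimeasurable with \<open>F\<close>.\<close>

lemma patch_level:
  assumes "0 \<le> a" "0 < p" "a + p \<le> 2" and F: "F \<in> borel_measurable half_line" and "0 \<le> l"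
  shows "{t. 0 < t \<and> l < \<bar>patch a p F t\<bar>} \<in> sets lebesgue"
    and "emeasure lebesgue {t. 0 < t \<and> l < \<bar>patch a p F t\<bar>} =
      ennreal p * emeasure lebesgue {x. 0 < x \<and> l < \<bar>F x\<bar>}"
proof -
  have eq: "{t. 0 < t \<and> l < \<bar>patch a p F t\<bar>} =
      {t \<in> patch_dom a p. patch_arg a p t \<in> {x. 0 < x \<and> l < \<bar>F x\<bar>}}"
    using assms by (auto simp: patch_def patch_arg_pos split: if_splits)
  show "{t. 0 < t \<and> l < \<bar>patch a p F t\<bar>} \<in> sets lebesgue"
    unfolding eq by (intro patch_preimage_measure assms half_line_level)
  have "{x. 0 < x \<and> l < \<bar>F x\<bar>} \<inter> {0<..} = {x. 0 < x \<and> l < \<bar>F x\<bar>}" by auto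
  then show "emeasure lebesgue {t. 0 < t \<and> l < \<bar>patch a p F t\<bar>} =
      ennreal p * emeasure lebesgue {x. 0 < x \<and> l < \<bar>F x\<bar>}"
    unfolding eq using patch_preimage_measure(2)[OF assms(1-3) half_line_level(2)[OF F]] by metis
qed

lemma patch_disjoint: "0 < p \<Longrightarrow> patch a p F t = 0 \<or> patch (a + p) q F t = 0"
  by (auto simp: patch_def patch_dom_def)

text \<open>The supports are disjoint, so the distribution functions add. Only the total width
  \<open>p + q\<close> enters, hence different splittings of the same width give equimeasurable
  sums.\<close>

lemma two_patches_level:
  assumes "0 \<le> a" "0 < p" "0 < q" "a + p + q \<le> 2"
    and F: "F \<in> borel_measurable half_line" and "0 \<le> l"
  shows "emeasure lebesgue {t. 0 < t \<and> l < \<bar>patch a p F t + patch (a + p) q F t\<bar>} =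
    ennreal (p + q) * emeasure lebesgue {x. 0 < x \<and> l < \<bar>F x\<bar>}"
proof -
  let ?A = "{t. 0 < t \<and> l < \<bar>patch a p F t\<bar>}" and ?B = "{t. 0 < t \<and> l < \<bar>patch (a + p) q F t\<bar>}"
  have "{t. 0 < t \<and> l < \<bar>patch a p F t + patch (a + p) q F t\<bar>} = ?A \<union> ?B"
  proof (intro set_eqI)
    fix t show "t \<in> {t. 0 < t \<and> l < \<bar>patch a p F t + patch (a + p) q F t\<bar>} \<longleftrightarrow> t \<in> ?A \<union> ?B"
      using patch_disjoint[OF assms(2), of a F t q] \<open>0 \<le> l\<close> by auto
  qed
  moreover have "?A \<inter> ?B = {}"
  proof -
    have False if "t \<in> ?A" "t \<in> ?B" for t
      using that patch_disjoint[OF assms(2), of a F t q] \<open>0 \<le> l\<close> by auto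
    then show ?thesis by blast
  qed
  ultimately have "emeasure lebesgue {t. 0 < t \<and> l < \<bar>patch a p F t + patch (a + p) q F t\<bar>} =
      emeasure lebesgue ?A + emeasure lebesgue ?B"
    using plus_emeasure[of ?A lebesgue ?B] patch_level(1)[of _ _ F l] assms by (simp del: emeasure_completion)
  also have "\<dots> = ennreal (p + q) * emeasure lebesgue {x. 0 < x \<and> l < \<bar>F x\<bar>}"
    using assms by (simp add: patch_level distrib_right del: emeasure_completion)
  finally show ?thesis .
qed

section \<open>Dilation norms, the Boyd index and Hardy averages\<close>

locale half_line_ri_space = ri_space half_line N for N :: "(real \<Rightarrow> real) \<Rightarrow> ennreal"
begin

lemma norm_eq_half_line:
  assumes "F \<in> borel_measurable half_line" "G \<in> borel_measurable half_line"
    and eq: "\<And>l. 0 \<le> l \<Longrightarrow>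
      emeasure lebesgue {x. 0 < x \<and> l < \<bar>F x\<bar>} = emeasure lebesgue {x. 0 < x \<and> l < \<bar>G x\<bar>}"
  shows "N F = N G"
proof (rule norm_eq_distribution[OF assms(1,2)])
  fix l :: real assume "0 \<le> l"
  from eq[OF this] show "emeasure half_line {x \<in> space half_line. l < \<bar>F x\<bar>} =
      emeasure half_line {x \<in> space half_line. l < \<bar>G x\<bar>}"
    by (subst (1 2) emeasure_half_line) auto
qed

text \<open>The dilated function is equimeasurable with one patch of width \<open>s\<close>. Adding
  a patch of the positive width \<open>2 - s\<close> gives total width 2, the same as two patches of
  width 1; each of these has norm \<open>N F\<close>, and the triangle inequality gives the factor
  2.\<close>

lemma norm_dilation_lt2:
  assumes F: "F \<in> borel_measurable half_line" and s: "1 < s" "s < 2"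
  shows "N (\<lambda>t. F (t / s)) \<le> 2 * N F"
proof -
  note [measurable] = F
  have [measurable]: "patch 0 s F \<in> borel_measurable half_line"
    "patch s (2 - s) F \<in> borel_measurable half_line"
    "patch 0 1 F \<in> borel_measurable half_line" "patch 1 1 F \<in> borel_measurable half_line"
    using s F by (auto intro!: patch_measurable)
  have "N (\<lambda>t. F (t / s)) = N (patch 0 s F)"
    using s F by (intro norm_eq_half_line dilation_measurable)
      (simp_all only: emeasure_dilation_level patch_level, auto)
  also have "\<dots> \<le> N (\<lambda>t. patch 0 s F t + patch s (2 - s) F t)"
  proof (intro lattice AE_I2)
    show "\<bar>patch 0 s F t\<bar> \<le> \<bar>patch 0 s F t + patch s (2 - s) F t\<bar>" for t
      using patch_disjoint[of s 0 F t "2 - s"] s by auto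
  qed auto
  also have "\<dots> = N (\<lambda>t. patch 0 1 F t + patch 1 1 F t)"
  proof (rule norm_eq_half_line)
    fix l :: real assume "0 \<le> l"
    with s F two_patches_level[of 0 s "2 - s" F l] two_patches_level[of 0 1 1 F l]
    show "emeasure lebesgue {x. 0 < x \<and> l < \<bar>patch 0 s F x + patch s (2 - s) F x\<bar>} =
        emeasure lebesgue {x. 0 < x \<and> l < \<bar>patch 0 1 F x + patch 1 1 F x\<bar>}"
      by (simp del: emeasure_completion)
  qed auto
  also have "\<dots> \<le> N (patch 0 1 F) + N (patch 1 1 F)" by (intro norm_triangle) auto
  also have "N (patch 0 1 F) = N F"
    using F by (intro norm_eq_half_line) (auto simp del: emeasure_completion simp: patch_level)
  also have "N (patch 1 1 F) = N F"
    using F by (intro norm_eq_half_line) (auto simp del: emeasure_completion simp: patch_level)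
  also have "N F + N F = 2 * N F" by (simp add: mult_2)
  finally show ?thesis .
qed

text \<open>The bound for one dilation is available at functions of finite norm;
  \<open>h < \<infinity>\<close> and \<open>N F < \<infinity>\<close> keep all iterates within its
  scope.\<close>

lemma norm_dilation_power:
  assumes F: "F \<in> borel_measurable half_line" and s: "0 < s"
    and le: "\<And>F. F \<in> borel_measurable half_line \<Longrightarrow> N F < \<infinity> \<Longrightarrow> N (\<lambda>t. F (t / s)) \<le> h * N F"
    and h: "h < \<infinity>" and fin: "N F < \<infinity>"
  shows "N (\<lambda>t. F (t / s ^ m)) \<le> h ^ m * N F"
proof (induction m)
  case (Suc m)
  have m: "(\<lambda>t. F (t / s ^ m)) \<in> borel_measurable half_line"
    using F s by (intro dilation_measurable) auto
  have "h ^ m * N F < \<infinity>" using h fin by (simp add: ennreal_mult_less_top power_less_top_ennreal)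
  then have "N (\<lambda>t. F (t / s / s ^ m)) \<le> h * N (\<lambda>t. F (t / s ^ m))"
    using Suc by (intro le m) (auto intro: le_less_trans)
  also have "\<dots> \<le> h * (h ^ m * N F)" using Suc by (intro mult_left_mono) auto
  finally show ?case by (simp add: mult.assoc)
qed simp

text \<open>For large \<open>m\<close> the root \<open>r\<close> of order \<open>m\<close> of
  \<open>s\<close> is less than 2, so \<open>s\<close> is reached by \<open>m\<close> dilations,
  each costing a factor of at most 2.\<close>

lemma dilation_norm_finite:
  assumes "1 < s"
  shows "dilation_norm N s < \<infinity>"
proof -
  obtain m where m: "s < 2 ^ m" using real_arch_pow[of 2 s] by auto
  with assms have "0 < m" by (cases m) auto
  define r where "r = root m s"
  have r: "1 < r" "r < 2" "s = r ^ m"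
    using \<open>0 < m\<close> assms real_root_less_mono[OF \<open>0 < m\<close> m] unfolding r_def
    by (auto simp: real_root_power_cancel)
  have "dilation_norm N s \<le> 2 ^ m"
    unfolding dilation_norm_def
  proof (rule SUP_least, clarify)
    fix F assume F: "F \<in> borel_measurable half_line" "N F \<le> 1"
    have "N (\<lambda>t. F (t / r ^ m)) \<le> 2 ^ m * N F"
      using F r by (intro norm_dilation_power norm_dilation_lt2) (auto intro: le_less_trans)
    also have "\<dots> \<le> 2 ^ m * 1" using F by (intro mult_left_mono) auto
    finally show "N (\<lambda>t. F (t / s)) \<le> 2 ^ m" using r by simp
  qed
  also have "2 ^ m < (\<infinity>::ennreal)" by (simp add: power_less_top_ennreal)
  finally show ?thesis .
qed

text \<open>The supremum over the unit ball extends by homogeneity; finiteness of the left side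
  comes first, so that the comparison can be made between real numbers.\<close>

lemma norm_dilation_le:
  assumes F: "F \<in> borel_measurable half_line" and "1 < s" "N F < \<infinity>"
  shows "N (\<lambda>t. F (t / s)) \<le> dilation_norm N s * N F"
proof -
  have unit: "N (\<lambda>t. G (t / s)) \<le> dilation_norm N s"
    if "G \<in> borel_measurable half_line" "N G \<le> 1" for G
    unfolding dilation_norm_def using that by (intro SUP_upper) auto
  have Fs: "(\<lambda>t. F (t / s)) \<in> borel_measurable half_line"
    using F assms(2) by (intro dilation_measurable) auto
  have scaled: "ennreal c * N (\<lambda>t. F (t / s)) \<le> dilation_norm N s" if "0 < c" "ennreal c * N F \<le> 1" for c
    using unit[of "\<lambda>t. c * F t"] norm_scale[OF F, of c] norm_scale[OF Fs, of c] that F by simp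
  define n where "n = enn2real (N F)"
  have n: "N F = ennreal n" "0 \<le> n" using assms(3) by (auto simp: n_def)
  obtain d where d: "dilation_norm N s = ennreal d" "0 \<le> d"
    using dilation_norm_finite[OF assms(2)] by (cases "dilation_norm N s") auto
  have "N (\<lambda>t. F (t / s)) < \<infinity>"
  proof -
    \<comment> \<open>Dividing by \<open>n + 1\<close> rather than \<open>n\<close> also covers a
      function of norm zero.\<close>
    have "ennreal (1 / (n + 1)) * N F \<le> 1" using n(2) by (simp add: n(1) flip: ennreal_mult)
    then have "ennreal (1 / (n + 1)) * N (\<lambda>t. F (t / s)) < \<infinity>"
      using scaled[of "1 / (n + 1)"] n(2) d(1) by (auto intro: le_less_trans)
    then show ?thesis using n(2) by (auto simp: ennreal_mult_less_top)
  qed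
  then obtain b where b: "N (\<lambda>t. F (t / s)) = ennreal b" "0 \<le> b"
    by (cases "N (\<lambda>t. F (t / s))") auto
  have cb: "c * b \<le> d" if "0 < c" "c * n \<le> 1" for c
    using scaled[OF that(1)] that n(2) b d by (simp add: n(1) flip: ennreal_mult)
  have "b \<le> d * n"
  proof (cases "n = 0")
    case True
    have "b = 0"
    proof (rule ccontr)
      assume "b \<noteq> 0"
      \<comment> \<open>When \<open>n = 0\<close> every multiple lies in the unit ball; this factor
        scales the norm up to \<open>d + 1\<close>, beyond the bound \<open>d\<close>.\<close>
      then have "(d + 1) / b * b \<le> d" using b(2) d(2) True by (intro cb) auto
      with \<open>b \<noteq> 0\<close> show False by simp
    qed
    with True show ?thesis by simp
  next
    case False
    then have "1 / n * b \<le> d" using n(2) by (intro cb) auto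
    then show ?thesis using False n(2) by (simp add: field_simps)
  qed
  then show ?thesis using b d n by (simp flip: ennreal_mult)
qed

text \<open>An infinite \<open>dilation_norm\<close> would contribute \<open>ln 0 / ln s = 0\<close> to the Boyd index,
  so the finiteness of dilation norms is essential here.\<close>

lemma dilation_norm_less:
  assumes "upper_boyd_index N < 1"
  shows "\<exists>s>1. dilation_norm N s < ennreal s"
proof -
  obtain s where s: "1 < s" "ln (enn2real (dilation_norm N s)) / ln s < 1"
    using cInf_lessD[OF _ assms[unfolded upper_boyd_index_def]] by (auto simp: image_iff)
  have "enn2real (dilation_norm N s) < s"
  \<comment> \<open>The logarithm at zero is a default value and carries no information, so that
    case is settled by \<open>0 < s\<close>.\<close>
  proof (cases "enn2real (dilation_norm N s) = 0")
    case False
    then have pos: "0 < enn2real (dilation_norm N s)" using enn2real_nonneg[of "dilation_norm N s"] by linarith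
    have "ln (enn2real (dilation_norm N s)) < ln s" using s by (simp add: divide_less_eq)
    then show ?thesis using pos s by simp
  qed (use s in simp)
  then show ?thesis using s dilation_norm_finite[OF s(1)] by auto
qed

text \<open>Cutting \<open>{0<..<t}\<close> at the points \<open>t / s ^ k\<close> bounds the
  average of a decreasing function by a series of dilations by \<open>s ^ Suc k\<close> with weights
  \<open>1 / s ^ k\<close>. Their norms are at most a multiple of \<open>(h / s) ^ k\<close>,
  summable since \<open>h < s\<close>.\<close>

lemma hardy_averaging:
  assumes "upper_boyd_index N < 1"
  shows "\<exists>C>0. \<forall>R. antimono R \<longrightarrow> enorm half_line N R < \<infinity> \<longrightarrow>
    enorm half_line N (\<lambda>t. (\<integral>\<^sup>+x\<in>{0<..<t}. R x \<partial>lborel) / ennreal t) \<le> ennreal C * enorm half_line N R"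
proof -
  obtain s where s: "1 < s" "dilation_norm N s < ennreal s" using dilation_norm_less[OF assms] by blast
  then obtain h where h: "dilation_norm N s = ennreal h" "0 \<le> h" "h < s"
    by (cases "dilation_norm N s") (auto simp: ennreal_less_iff)
  \<comment> \<open>The quotient is the sum of the geometric series; adding 1 keeps \<open>C\<close>
    positive even when \<open>h = 0\<close>.\<close>
  define C where "C = h / (1 - h / s) + 1"
  have hs: "0 \<le> h / s" "h / s < 1" using h s by auto
  have C: "0 < C" unfolding C_def using hs h by (intro add_nonneg_pos divide_nonneg_nonneg) auto
  show ?thesis
  proof (intro exI[of _ C] conjI C allI impI)
    fix R :: "real \<Rightarrow> ennreal"
    assume R: "antimono R" and fin: "enorm half_line N R < \<infinity>"
    define P where "P t = (\<integral>\<^sup>+x\<in>{0<..<t}. R x \<partial>lborel) / ennreal t" for t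
    have [measurable]: "R \<in> borel_measurable borel" using R by (rule borel_measurable_monotone)
    have Rfin: "R t < \<infinity>" if "0 < t" for t
    proof -
      obtain x where x: "0 < x" "x < t" "R x < \<infinity>"
        using AE_half_line_exists[OF enorm_finiteD[OF fin] \<open>0 < t\<close>] by blast
      have "R t \<le> R x" using x by (intro antimonoD[OF R]) auto
      with x show ?thesis by simp
    qed
    define G where "G t = enn2real (R t)" for t
    have [measurable]: "G \<in> borel_measurable borel" unfolding G_def by measurable
    have RG: "R t = ennreal (G t)" if "0 < t" for t using Rfin[OF that] by (simp add: G_def)
    have G0: "0 \<le> G t" for t by (simp add: G_def)
    have NG: "enorm half_line N R = N G" "N G < \<infinity>"
      using fin enorm_finiteD[OF fin] unfolding enorm_def G_def by auto
    define u where "u k t = 1 / s ^ k * G (t / s ^ Suc k)" for k t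
    have [measurable]: "u k \<in> borel_measurable half_line" for k
      unfolding u_def[abs_def] by (intro borel_imp_half_line) measurable
    have Nu: "N (u k) \<le> ennreal ((h / s) ^ k * h) * N G" for k
    proof -
      have mG: "(\<lambda>t. G (t / s ^ Suc k)) \<in> borel_measurable half_line"
        by (intro borel_imp_half_line) measurable
      have "N (u k) = ennreal (1 / s ^ k) * N (\<lambda>t. G (t / s ^ Suc k))"
        unfolding u_def using s by (subst norm_scale[OF mG]) auto
      also have "N (\<lambda>t. G (t / s ^ Suc k)) \<le> ennreal h ^ Suc k * N G"
        using s NG norm_dilation_le[OF _ s(1), unfolded h(1)]
        by (intro norm_dilation_power borel_imp_half_line) auto
      also have "ennreal (1 / s ^ k) * (ennreal h ^ Suc k * N G) =
          ennreal (1 / s ^ k * h ^ Suc k) * N G"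
        using s h by (simp only: ennreal_power mult.assoc[symmetric] ennreal_mult[symmetric]
            zero_le_power zero_le_divide_1_iff order.trans[OF zero_le_one less_imp_le])
      also have "1 / s ^ k * h ^ Suc k = (h / s) ^ k * h" by (simp add: power_divide)
      finally show ?thesis by (simp add: mult_left_mono)
    qed
    have sum: "(\<Sum>k. N (u k)) \<le> ennreal C * N G"
    proof -
      have "(\<Sum>k. N (u k)) \<le> (\<Sum>k. ennreal ((h / s) ^ k * h) * N G)"
        by (intro suminf_le Nu) auto
      also have "\<dots> = (\<Sum>k. ennreal ((h / s) ^ k * h)) * N G" by simp
      also have "(\<Sum>k. ennreal ((h / s) ^ k * h)) = ennreal (1 / (1 - h / s) * h)"
        using hs h by (intro suminf_ennreal_eq sums_mult2 geometric_sums) auto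
      also have "ennreal (1 / (1 - h / s) * h) * N G \<le> ennreal C * N G"
        unfolding C_def by (intro mult_right_mono ennreal_leI) auto
      finally show ?thesis .
    qed
    also have "ennreal C * N G < \<infinity>" using NG by (simp add: ennreal_mult_less_top)
    finally have "(\<Sum>k. N (u k)) < \<infinity>" .
    from countable_subadditive[OF _ _ this]
    obtain f where f [measurable]: "f \<in> borel_measurable half_line"
      and Nf: "N f \<le> (\<Sum>k. N (u k))" and le: "AE t in half_line. \<forall>n. (\<Sum>k<n. u k t) \<le> f t"
      using G0 s by (auto simp: u_def)
    have Pu: "P t \<le> (\<Sum>k. ennreal (u k t))" if t: "0 < t" for t
    proof -
      have ex: "\<exists>k. t / s ^ Suc k \<le> x \<and> x < t / s ^ k" if x: "0 < x" "x < t" for x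
      proof -
        obtain n where "t / x < s ^ n" using real_arch_pow[OF s(1)] by blast
        then have n: "t / s ^ n \<le> x" using x s by (simp add: field_simps)
        \<comment> \<open>The least exponent is positive because \<open>x < t\<close>, and its
          predecessor gives the interval containing \<open>x\<close>.\<close>
        define m where "m = (LEAST n. t / s ^ n \<le> x)"
        have m: "t / s ^ m \<le> x" unfolding m_def using n by (rule LeastI)
        then obtain k where k: "m = Suc k" using x by (cases m) auto
        have "\<not> t / s ^ k \<le> x" using not_less_Least[of k "\<lambda>n. t / s ^ n \<le> x"] k m_def by auto
        with m k show ?thesis by auto
      qed
      have "(\<integral>\<^sup>+x\<in>{0<..<t}. R x \<partial>lborel) \<le>
          (\<integral>\<^sup>+x. (\<Sum>k. R (t / s ^ Suc k) * indicator {t / s ^ Suc k..<t / s ^ k} x) \<partial>lborel)"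
      proof (intro nn_integral_mono)
        fix x
        show "R x * indicator {0<..<t} x \<le>
            (\<Sum>k. R (t / s ^ Suc k) * indicator {t / s ^ Suc k..<t / s ^ k} x)"
        proof (cases "x \<in> {0<..<t}")
          case True
          then obtain k where k: "t / s ^ Suc k \<le> x" "x < t / s ^ k" using ex by auto
          have "R x \<le> R (t / s ^ Suc k)" using k(1) by (rule antimonoD[OF R])
          also have "\<dots> = (\<Sum>k\<in>{k}. R (t / s ^ Suc k) * indicator {t / s ^ Suc k..<t / s ^ k} x)"
            using k by simp
          also have "\<dots> \<le> (\<Sum>k. R (t / s ^ Suc k) * indicator {t / s ^ Suc k..<t / s ^ k} x)"
            by (intro sum_le_suminf) auto
          finally show ?thesis using True by simp
        qed simp
      qed
      also have "\<dots> = (\<Sum>k. R (t / s ^ Suc k) * ennreal (t / s ^ k - t / s ^ Suc k))"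
        using s t by (subst nn_integral_suminf)
          (auto simp: nn_integral_cmult_indicator divide_left_mono mult_left_le field_simps simp del: power_Suc intro!: suminf_cong)
      also have "\<dots> \<le> (\<Sum>k. ennreal (u k t) * ennreal t)"
      proof (intro suminf_le)
        fix k
        \<comment> \<open>The length of the interval is bounded by its right endpoint
          \<open>t / s ^ k\<close>, which supplies the weight \<open>1 / s ^ k\<close> in
          \<open>u k\<close>.\<close>
        have "R (t / s ^ Suc k) * ennreal (t / s ^ k - t / s ^ Suc k) \<le>
            ennreal (G (t / s ^ Suc k)) * ennreal (t / s ^ k)"
          using s t by (subst RG) (auto intro!: mult_left_mono ennreal_leI)
        also have "\<dots> = ennreal (u k t) * ennreal t"
          using s t G0 by (simp add: u_def flip: ennreal_mult)
        finally show "R (t / s ^ Suc k) * ennreal (t / s ^ k - t / s ^ Suc k) \<le> ennreal (u k t) * ennreal t" .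
      qed auto
      also have "\<dots> = (\<Sum>k. ennreal (u k t)) * ennreal t" by simp
      finally have "P t \<le> (\<Sum>k. ennreal (u k t)) * ennreal t / ennreal t"
        unfolding P_def by (rule divide_right_mono_ennreal)
      then show ?thesis using t by (simp add: ennreal_mult_divide_eq)
    qed
    have "AE t in half_line. P t \<le> ennreal (f t)"
      using le AE_space
    proof eventually_elim
      case (elim t)
      have "P t \<le> (\<Sum>k. ennreal (u k t))" using elim by (intro Pu) simp
      also have "\<dots> \<le> ennreal (f t)"
      proof (rule suminf_le_const)
        fix n
        have "(\<Sum>k<n. ennreal (u k t)) = ennreal (\<Sum>k<n. u k t)"
          using G0 s by (intro sum_ennreal) (auto simp: u_def)
        also have "\<dots> \<le> ennreal (f t)" using elim by (intro ennreal_leI) auto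
        finally show "(\<Sum>k<n. ennreal (u k t)) \<le> ennreal (f t)" .
      qed auto
      finally show ?case .
    qed
    moreover have "P \<in> borel_measurable half_line"
      unfolding P_def[abs_def] by (intro borel_imp_half_line average_measurable)
    ultimately have "enorm half_line N P \<le> enorm half_line N (\<lambda>t. ennreal (f t))"
      by (intro enorm_mono) (auto intro: ri_space_axioms)
    also have "\<dots> \<le> N f"
    proof -
      \<comment> \<open>Conversion to \<open>ennreal\<close> cuts off the negative part of
        \<open>f\<close>; the lattice property absorbs this.\<close>
      have "\<bar>enn2real (ennreal (f t))\<bar> \<le> \<bar>f t\<bar>" for t
        by (cases "0 \<le> f t") (auto simp: ennreal_neg)
      then have "N (\<lambda>t. enn2real (ennreal (f t))) \<le> N f" by (intro lattice AE_I2) auto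
      then show ?thesis by (simp add: enorm_def)
    qed
    also have "\<dots> \<le> ennreal C * N G" using Nf sum by (rule order_trans)
    finally show "enorm half_line N (\<lambda>t. (\<integral>\<^sup>+x\<in>{0<..<t}. R x \<partial>lborel) / ennreal t)
        \<le> ennreal C * enorm half_line N R"
      unfolding P_def NG .
  qed
qed

end

section \<open>Sobolev type estimates and the measure of balls\<close>

lemma enorm_scale_le:
  assumes "ri_space M N" and [measurable]: "F \<in> borel_measurable M" and "0 < k"
  shows "enorm M N (\<lambda>x. ennreal k * F x) \<le> ennreal k * enorm M N F"
proof (cases "AE x in M. F x < \<infinity>")
  case True
  then have "AE x in M. ennreal k * F x < \<infinity>"
    by eventually_elim (simp add: ennreal_mult_less_top)
  moreover have "N (\<lambda>x. k * enn2real (F x)) = ennreal \<bar>k\<bar> * N (\<lambda>x. enn2real (F x))"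
    by (rule ri_space.norm_scale[OF assms(1)]) simp
  ultimately show ?thesis using True assms(3) by (simp add: enorm_def enn2real_mult)
qed (use assms(3) in \<open>simp add: enorm_def ennreal_mult_top\<close>)

section \<open>Pointwise control of the oscillation by the averaged gradient\<close>

text \<open>Averaging the rearranged pointwise bound produces \<open>a + \<rho> * b\<close> plus
  \<open>\<rho>\<close> times the average for \<open>g\<close>. Subtracting the rearrangement of
  \<open>f\<close> at \<open>t\<close> removes \<open>a\<close>, and \<open>b\<close> is at most the
  same average; hence the factor 2.\<close>

lemma rearr_osc_le_max_rearr_gradient:
  fixes M :: "'a::metric_space measure"
  assumes "metric_measure_space M" and Q: "0 < Q" and \<alpha>: "0 < \<alpha>" and c: "0 < c"
    and balls: "\<And>x r. 0 < r \<Longrightarrow> ennreal (c * r powr Q) \<le> emeasure M (ball x r)"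
    and f [measurable]: "f \<in> borel_measurable M" and g: "g \<in> hajlasz_gradients M \<alpha> f"
    and t: "0 < t" and fint: "rearr M f t < \<infinity>" and fing: "\<And>s. 0 < s \<Longrightarrow> rearr M g s < \<infinity>"
  shows "rearr_osc M f t \<le> ennreal (2 * (3 * t / c) powr (\<alpha> / Q)) * max_rearr M g t"
proof -
  interpret metric_measure_space M by fact
  have sp [simp]: "space M = UNIV" using sets_eq_imp_space_eq[OF sets_eq_borel] by simp
  have [measurable]: "g \<in> borel_measurable M" using g by (simp add: hajlasz_gradients_def)
  have ball_sets: "ball x r \<in> sets M" for x :: 'a and r by (simp add: sets_eq_borel)
  from g obtain E where E: "E \<in> null_sets M" and g0: "\<And>x. 0 \<le> g x"
    and fg: "\<And>x y. x \<notin> E \<Longrightarrow> y \<notin> E \<Longrightarrow> \<bar>f x - f y\<bar> \<le> dist x y powr \<alpha> * (g x + g y)"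
    by (auto simp: hajlasz_gradients_def)
  \<comment> \<open>With this radius every ball has measure at least \<open>3 * t\<close>, while the
    points with large \<open>f\<close>, those with large \<open>g\<close> and the exceptional set
    together have measure at most \<open>2 * t\<close>.\<close>
  define r where "r = (3 * t / c) powr (1 / Q)"
  have r: "0 < r" "c * r powr Q = 3 * t" using Q t c by (auto simp: r_def powr_powr)
  define \<rho> where "\<rho> = r powr \<alpha>"
  have \<rho>: "\<rho> = (3 * t / c) powr (\<alpha> / Q)" "0 < \<rho>" using r by (auto simp: \<rho>_def r_def powr_powr)
  define a where "a = enn2real (rearr M f t)"
  define b where "b = enn2real (rearr M g t)"
  have a: "rearr M f t = ennreal a" "0 \<le> a" using fint by (auto simp: a_def)
  have b: "rearr M g t = ennreal b" "0 \<le> b" using fing[OF t] by (auto simp: b_def)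
  have fb: "\<bar>f x\<bar> \<le> a + \<rho> * (g x + b)" if x: "x \<notin> E" for x
  proof -
    define A B where "A = {y \<in> space M. a < \<bar>f y\<bar>}" and "B = {y \<in> space M. b < \<bar>g y\<bar>}"
    have [measurable]: "A \<in> sets M" "B \<in> sets M" unfolding A_def B_def by measurable
    have [measurable]: "E \<in> sets M" using E by auto
    have "emeasure M (A \<union> B \<union> E) \<le> emeasure M A + emeasure M B + emeasure M E"
      by (intro order_trans[OF emeasure_subadditive] add_right_mono) auto
    also have "\<dots> \<le> ennreal t + ennreal t + 0"
      unfolding A_def B_def a_def b_def using E fint fing[OF t]
      by (intro add_mono emeasure_above_rearr_le) auto
    also have "\<dots> < ennreal (3 * t)" using t by (simp flip: ennreal_plus add: ennreal_less_iff)
    also have "\<dots> \<le> emeasure M (ball x r)" using balls[OF r(1), of x] r(2) by simp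
    finally have "\<not> ball x r \<subseteq> A \<union> B \<union> E"
      using emeasure_mono[of "ball x r" "A \<union> B \<union> E" M] by auto
    then obtain y where "y \<in> ball x r" "y \<notin> A" "y \<notin> B" "y \<notin> E" by blast
    then have y: "dist x y < r" "\<bar>f y\<bar> \<le> a" "g y \<le> b" "y \<notin> E"
      using g0[of y] by (auto simp: A_def B_def)
    have "\<bar>f x - f y\<bar> \<le> dist x y powr \<alpha> * (g x + g y)" by (rule fg) fact+
    also have "\<dots> \<le> \<rho> * (g x + b)"
      unfolding \<rho>_def using y \<alpha> g0[of x] g0[of y] by (intro mult_mono powr_mono2) auto
    finally show ?thesis using y by linarith
  qed
  have rearr_le': "rearr M f s \<le> ennreal (a + \<rho> * b) + ennreal \<rho> * rearr M g s" if s: "0 < s" for s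
  proof -
    define l where "l = enn2real (rearr M g s)"
    have l: "rearr M g s = ennreal l" "0 \<le> l" using fing[OF s] by (auto simp: l_def)
    \<comment> \<open>By \<open>fb\<close>, exceeding this level at a point outside \<open>E\<close>
      forces \<open>g\<close> to exceed \<open>l\<close>.\<close>
    have "emeasure M {x \<in> space M. a + \<rho> * b + \<rho> * l < \<bar>f x\<bar>} \<le>
        emeasure M {x \<in> space M. l < \<bar>g x\<bar>}"
    proof (rule emeasure_mono_AE)
      show "AE x in M. x \<in> {x \<in> space M. a + \<rho> * b + \<rho> * l < \<bar>f x\<bar>} \<longrightarrow> x \<in> {x \<in> space M. l < \<bar>g x\<bar>}"
        using AE_not_in[OF E]
      proof eventually_elim
        case (elim x)
        have "\<rho> * l < \<rho> * g x" if "a + \<rho> * b + \<rho> * l < \<bar>f x\<bar>"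
          using fb[OF elim] that by (simp add: algebra_simps)
        then show ?case using \<rho>(2) by auto
      qed
    qed measurable
    also have "\<dots> \<le> ennreal s" unfolding l_def using fing[OF s] by (intro emeasure_above_rearr_le) auto
    finally have "rearr M f s \<le> ennreal (a + \<rho> * b + \<rho> * l)"
      using a b l \<rho> by (intro rearr_le) auto
    also have "\<dots> = ennreal (a + \<rho> * b) + ennreal \<rho> * rearr M g s"
      using a b l \<rho> by (simp add: ennreal_plus ennreal_mult del: ennreal_plus_if)
    finally show ?thesis .
  qed
  have "(\<integral>\<^sup>+s\<in>{0<..<t}. rearr M f s \<partial>lborel) \<le>
      (\<integral>\<^sup>+s. ennreal (a + \<rho> * b) * indicator {0<..<t} s +
        ennreal \<rho> * (rearr M g s * indicator {0<..<t} s) \<partial>lborel)"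
    using rearr_le' by (intro nn_integral_mono) (auto split: split_indicator)
  also have "\<dots> = ennreal (a + \<rho> * b) * ennreal t + ennreal \<rho> * (\<integral>\<^sup>+s\<in>{0<..<t}. rearr M g s \<partial>lborel)"
    using t by (simp add: nn_integral_add nn_integral_cmult nn_integral_cmult_indicator)
  finally have "max_rearr M f t \<le> (ennreal (a + \<rho> * b) * ennreal t +
      ennreal \<rho> * (\<integral>\<^sup>+s\<in>{0<..<t}. rearr M g s \<partial>lborel)) / ennreal t"
    unfolding max_rearr_def by (rule divide_right_mono_ennreal)
  also have "\<dots> = ennreal (a + \<rho> * b) + ennreal \<rho> * max_rearr M g t"
    using t by (simp add: max_rearr_def add_divide_distrib_ennreal ennreal_mult_divide_eq ennreal_times_divide)
  also have "ennreal (a + \<rho> * b) = ennreal a + ennreal \<rho> * ennreal b"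
    using a b \<rho> by (simp add: ennreal_plus ennreal_mult del: ennreal_plus_if)
  \<comment> \<open>A decreasing function is at most its mean over the preceding interval.\<close>
  also have "ennreal b \<le> max_rearr M g t"
  proof -
    have "ennreal b * ennreal t = (\<integral>\<^sup>+s. ennreal b * indicator {0<..<t} s \<partial>lborel)"
      using t by (simp add: nn_integral_cmult_indicator)
    also have "\<dots> \<le> (\<integral>\<^sup>+s\<in>{0<..<t}. rearr M g s \<partial>lborel)"
      unfolding b(1)[symmetric]
      by (intro nn_integral_mono) (auto split: split_indicator intro: rearr_antimono)
    finally have "ennreal b * ennreal t / ennreal t \<le> max_rearr M g t"
      unfolding max_rearr_def by (rule divide_right_mono_ennreal)
    then show ?thesis using t by (simp add: ennreal_mult_divide_eq)
  qed
  finally have "max_rearr M f t \<le>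
      ennreal a + (ennreal \<rho> * max_rearr M g t + ennreal \<rho> * max_rearr M g t)"
    by (simp add: add_mono mult_left_mono add.assoc)
  then have "rearr_osc M f t \<le> ennreal \<rho> * max_rearr M g t + ennreal \<rho> * max_rearr M g t"
    unfolding rearr_osc_def a(1) by (simp add: ennreal_minus_le_iff)
  also have "\<dots> = ennreal (2 * \<rho>) * max_rearr M g t"
  proof -
    have "ennreal (2 * \<rho>) = ennreal \<rho> + ennreal \<rho>" using \<rho>(2) by (simp flip: ennreal_plus)
    then show ?thesis by (simp only: distrib_right)
  qed
  finally show ?thesis unfolding \<rho>(1) .
qed

section \<open>Cutoff functions and the growth of balls\<close>

text \<open>The function never exceeds \<open>k\<close> and is nonzero on a set of measure at most
  \<open>V\<close>, so its rearrangement is dominated by \<open>k\<close> times the indicator of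
  \<open>{0<..<V}\<close>.\<close>

lemma norm_scaled_indicator_le:
  assumes "is_representation M N Nbar" and [measurable]: "A \<in> sets M"
    and V: "emeasure M A = ennreal V" and k: "0 \<le> k"
  shows "N (\<lambda>y. k * indicator A y) \<le> ennreal k * Nbar (indicator {0<..<V})"
proof -
  have Nbar: "ri_space half_line Nbar"
    and rep: "\<And>f. f \<in> borel_measurable M \<Longrightarrow> N f = enorm half_line Nbar (rearr M f)"
    using assms(1) by (auto simp: is_representation_def)
  let ?f = "\<lambda>y. k * indicator A y :: real"
  have le: "rearr M ?f t \<le> ennreal (k * indicator {0<..<V} t)" if "0 < t" for t
  proof (cases "t < V")
    case True
    have *: "{x \<in> space M. k < \<bar>?f x\<bar>} = {}" using k by (auto simp: indicator_def)
    have "rearr M ?f t \<le> ennreal k" using k by (intro rearr_le) (simp_all only: *, simp)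
    then show ?thesis using True that by simp
  next
    case False
    have "emeasure M {x \<in> space M. 0 < \<bar>?f x\<bar>} \<le> emeasure M A"
      by (intro emeasure_mono) (auto simp: indicator_def split: if_splits)
    also have "\<dots> \<le> ennreal t" using False V by (simp add: ennreal_leI)
    finally have "rearr M ?f t \<le> ennreal 0" by (intro rearr_le) auto
    then show ?thesis using False by simp
  qed
  have "N ?f = enorm half_line Nbar (rearr M ?f)" by (rule rep) measurable
  also have "\<dots> \<le> enorm half_line Nbar (\<lambda>t. ennreal (k * indicator {0<..<V} t))"
    using le by (intro enorm_mono[OF Nbar] borel_imp_half_line AE_I2) auto
  also have "\<dots> = Nbar (\<lambda>t. k * indicator {0<..<V} t)" using k by (simp add: enorm_def)
  also have "\<dots> = ennreal k * Nbar (indicator {0<..<V})"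
    using k by (subst ri_space.norm_scale[OF Nbar]) (auto intro!: borel_imp_half_line)
  finally show ?thesis .
qed

text \<open>Intervals of equal length are equimeasurable. The shifted one is where the oscillation
  of a cutoff is bounded below, the other bounds the norm of its gradient; positivity and finiteness
  allow the common factor to be cancelled.\<close>

lemma (in half_line_ri_space) norm_indicator_interval:
  assumes "0 < V"
  shows "N (indicator {V<..<2 * V}) = N (indicator {0<..<V})"
    and "0 < N (indicator {0<..<V})" "N (indicator {0<..<V}) < \<infinity>"
proof -
  have S: "{0<..<V} \<in> sets half_line" by (auto simp: sets_half_line_iff)
  have e: "emeasure half_line {0<..<V} = ennreal V" using assms by (subst emeasure_half_line) auto
  show "0 < N (indicator {0<..<V})" "N (indicator {0<..<V}) < \<infinity>"
    using norm_indicator_pos[OF S] norm_indicator_finite[OF S] e assms by auto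
  show "N (indicator {V<..<2 * V}) = N (indicator {0<..<V})"
  proof (rule norm_eq_half_line)
    fix l :: real assume l: "0 \<le> l"
    have *: "{x. 0 < x \<and> l < \<bar>indicator {a<..<b} x\<bar>} = (if l < 1 then {a<..<b} else {})"
      if "0 \<le> a" for a b :: real using that l by (auto simp: indicator_def split: if_splits)
    show "emeasure lebesgue {x. 0 < x \<and> l < \<bar>indicator {V<..<2 * V} x\<bar>} =
        emeasure lebesgue {x. 0 < x \<and> l < \<bar>indicator {0<..<V} x\<bar>}"
      using assms by (simp only: *) simp
  qed (auto intro!: borel_imp_half_line)
qed

text \<open>Inserting a cutoff function into the embedding produces the norm of an interval of
  length \<open>V\<close> on both sides. It cancels, leaving an inequality between ball measures in
  which the norm no longer appears.\<close>

lemma ball_growth_inequality: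
  fixes M :: "'a::metric_space measure"
  assumes "metric_measure_space M" and Q: "0 < Q" and \<alpha>: "0 < \<alpha>" "\<alpha> \<le> 1"
    and "ri_space M N" and rep: "is_representation M N Nbar" and C: "0 < C"
    and ineq: "\<And>f. f \<in> hajlasz_space M N \<alpha> \<Longrightarrow>
      enorm half_line Nbar (\<lambda>t. ennreal (t powr (- \<alpha> / Q)) * rearr_osc M f t)
        \<le> ennreal C * hajlasz_seminorm M N \<alpha> f"
    and \<rho>: "0 < \<rho>" "\<rho> < r"
  shows "(2 * measure M (ball x r)) powr (- \<alpha> / Q) * (measure M (ball x \<rho>) / (2 * measure M (ball x r)))
    \<le> C * (r - \<rho>) powr (- \<alpha>)"
proof -
  interpret metric_measure_space M by fact
  interpret X: ri_space M N by fact
  interpret Xbar: half_line_ri_space Nbar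
    using rep unfolding half_line_ri_space_def is_representation_def by blast
  have sp [simp]: "space M = UNIV" using sets_eq_imp_space_eq[OF sets_eq_borel] by simp
  have meas: "borel_measurable M = borel_measurable borel"
    by (rule measurable_cong_sets) (simp_all add: sets_eq_borel)
  have ball_sets: "ball y s \<in> sets M" for y :: 'a and s by (simp add: sets_eq_borel)
  define V W where "V = measure M (ball x r)" and "W = measure M (ball x \<rho>)"
  have eV: "emeasure M (ball x r) = ennreal V" and eW: "emeasure M (ball x \<rho>) = ennreal W"
    unfolding V_def W_def using ball_finite[of x r] ball_finite[of x \<rho>]
    by (auto intro!: emeasure_eq_ennreal_measure)
  have V: "0 < V" and W: "0 < W" using ball_pos[of r x] ball_pos[of \<rho> x] \<rho> eV eW by auto
  have "ennreal W \<le> ennreal V"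
    unfolding eV[symmetric] eW[symmetric] using \<rho> by (intro emeasure_mono ball_sets) auto
  then have WV: "W \<le> V" using V by simp
  define \<delta> where "\<delta> = r - \<rho>"
  have \<delta>: "0 < \<delta>" using \<rho> by (simp add: \<delta>_def)
  \<comment> \<open>The cutoff is 1 on the inner ball, 0 off the outer one, and linear in the
    distance to \<open>x\<close> in between, with Lipschitz constant
    \<open>1 / \<delta>\<close>.\<close>
  define u where "u y = max 0 (min 1 ((r - dist x y) / \<delta>))" for y
  have u01: "0 \<le> u y" "u y \<le> 1" for y by (auto simp: u_def)
  have u0: "u y = 0" if "y \<notin> ball x r" for y
    using that \<delta> by (simp add: u_def divide_nonpos_pos max_absorb1)
  have u1: "u y = 1" if "y \<in> ball x \<rho>" for y
    using that \<delta> by (simp add: u_def \<delta>_def min_absorb1)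
  have um [measurable]: "u \<in> borel_measurable M"
    unfolding meas u_def[abs_def] using \<delta> by (intro borel_measurable_continuous_onI continuous_intros) auto
  define g where "g y = \<delta> powr (- \<alpha>) * indicator (ball x r) y" for y
  have [measurable]: "g \<in> borel_measurable M"
    unfolding g_def[abs_def] using ball_sets by measurable
  have lip: "\<bar>u y - u z\<bar> \<le> dist y z powr \<alpha> * \<delta> powr (- \<alpha>)" for y z
  proof -
    \<comment> \<open>The difference is bounded both by 1 and by \<open>q\<close>, and the smaller
      of these is at most \<open>q powr \<alpha>\<close> because \<open>0 < \<alpha>\<close> and
      \<open>\<alpha> \<le> 1\<close>.\<close>
    define q where "q = dist y z / \<delta>"
    have "\<bar>u y - u z\<bar> \<le> \<bar>(r - dist x y) / \<delta> - (r - dist x z) / \<delta>\<bar>"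
      unfolding u_def by linarith
    also have "\<dots> = \<bar>dist x z - dist x y\<bar> / \<delta>"
      using \<delta> by (simp add: diff_divide_distrib[symmetric] abs_divide)
    also have "\<dots> \<le> q" unfolding q_def using \<delta> dist_triangle[of x z y] dist_triangle[of x y z]
      by (intro divide_right_mono) (auto simp: dist_commute abs_le_iff)
    finally have 1: "\<bar>u y - u z\<bar> \<le> q" .
    have 2: "\<bar>u y - u z\<bar> \<le> 1" using u01[of y] u01[of z] by linarith
    have q: "0 \<le> q" using \<delta> by (simp add: q_def)
    have "\<bar>u y - u z\<bar> \<le> q powr \<alpha>"
    proof (cases "1 \<le> q")
      case True
      then show ?thesis using 2 \<alpha> ge_one_powr_ge_zero[of q \<alpha>] by linarith
    next
      case False
      then have "q powr 1 \<le> q powr \<alpha>" using q \<alpha> powr_mono'[of \<alpha> 1 q] by simp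
      then show ?thesis using 1 q by simp
    qed
    also have "\<dots> = dist y z powr \<alpha> * \<delta> powr (- \<alpha>)"
      using \<delta> by (simp add: q_def powr_divide powr_minus_divide)
    finally show ?thesis .
  qed
  have grad: "g \<in> hajlasz_gradients M \<alpha> u"
  proof -
    have "\<bar>u y - u z\<bar> \<le> dist y z powr \<alpha> * (g y + g z)" for y z
    \<comment> \<open>If either point is in the outer ball, \<open>g\<close> there already supplies
      the factor from \<open>lip\<close>; otherwise both values of \<open>u\<close> vanish.\<close>
    proof (cases "y \<in> ball x r \<or> z \<in> ball x r")
      case True
      then have "\<delta> powr (- \<alpha>) \<le> g y + g z" by (auto simp: g_def indicator_def)
      then show ?thesis using lip[of y z] by (meson mult_left_mono order_trans powr_ge_zero)
    qed (use u0[of y] u0[of z] in \<open>auto simp: g_def\<close>)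
    then show ?thesis by (auto simp: hajlasz_gradients_def g_def[of y for y] intro!: bexI[of _ "{}"])
  qed
  have Ng: "N g \<le> ennreal (\<delta> powr (- \<alpha>)) * Nbar (indicator {0<..<V})"
    unfolding g_def[abs_def] by (rule norm_scaled_indicator_le[OF rep ball_sets eV]) simp
  note ind = Xbar.norm_indicator_interval[OF V]
  have semi: "hajlasz_seminorm M N \<alpha> u \<le> N g"
    unfolding hajlasz_seminorm_def using grad by (rule INF_lower)
  have "N u \<le> N (\<lambda>y. 1 * indicator (ball x r) y)"
  proof (rule X.lattice)
    show "AE y in M. \<bar>u y\<bar> \<le> \<bar>1 * indicator (ball x r) y\<bar>"
      using u01 u0 by (intro AE_I2) (auto simp: indicator_def)
  qed (use ball_sets in measurable)
  also have "\<dots> \<le> ennreal 1 * Nbar (indicator {0<..<V})"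
    by (rule norm_scaled_indicator_le[OF rep ball_sets eV]) simp
  also have "\<dots> < \<infinity>" using ind by simp
  finally have "u \<in> space_of M N" by (simp add: space_of_def)
  moreover have "N g < \<infinity>" using ind by (intro le_less_trans[OF Ng]) (simp add: ennreal_mult_less_top)
  ultimately have "u \<in> hajlasz_space M N \<alpha>" using semi by (auto simp: hajlasz_space_def)
  note main = ineq[OF this]
  have r0: "rearr M u t = 0" if "V \<le> t" for t
  proof -
    have "y \<in> ball x r" if "0 < \<bar>u y\<bar>" for y using u0[of y] that by fastforce
    then have "emeasure M {y \<in> space M. 0 < \<bar>u y\<bar>} \<le> emeasure M (ball x r)"
      by (intro emeasure_mono ball_sets) blast
    also have "\<dots> \<le> ennreal t" using eV that by (simp add: ennreal_leI)
    finally have "rearr M u t \<le> ennreal 0" by (intro rearr_le) auto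
    then show ?thesis by simp
  qed
  have r1: "1 \<le> rearr M u s" if "0 < s" "s < W" for s
  proof -
    have "ennreal 1 \<le> rearr M u s"
    proof (rule rearr_ge)
      fix l :: real assume "0 \<le> l" "l < 1"
      have "ennreal s < emeasure M (ball x \<rho>)" unfolding eW using that by (simp add: ennreal_less_iff)
      also have "\<dots> \<le> emeasure M {y \<in> space M. l < \<bar>u y\<bar>}"
      proof (rule emeasure_mono)
        show "{y \<in> space M. l < \<bar>u y\<bar>} \<in> sets M" by measurable
      qed (use u1 \<open>l < 1\<close> in auto)
      finally show "ennreal s < emeasure M {y \<in> space M. l < \<bar>u y\<bar>}" .
    qed
    then show ?thesis by simp
  qed
  define k where "k = (2 * V) powr (- \<alpha> / Q) * (W / (2 * V))"
  have k: "0 < k" using V W by (simp add: k_def)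
  \<comment> \<open>For \<open>t\<close> between \<open>V\<close> and \<open>2 * V\<close> the
    rearrangement of \<open>u\<close> vanishes at \<open>t\<close>, while its integral up to
    \<open>t\<close> is at least \<open>W\<close>; so the oscillation is at least
    \<open>W / t\<close>.\<close>
  have low: "ennreal (k * indicator {V<..<2 * V} t) \<le> ennreal (t powr (- \<alpha> / Q)) * rearr_osc M u t" for t
  proof (cases "t \<in> {V<..<2 * V}")
    case True
    have "ennreal W = (\<integral>\<^sup>+s. indicator {0<..<W} s \<partial>lborel)" using W by simp
    also have "\<dots> \<le> (\<integral>\<^sup>+s\<in>{0<..<t}. rearr M u s \<partial>lborel)"
      using r1 True WV by (intro nn_integral_mono) (auto split: split_indicator)
    finally have "ennreal W / ennreal t \<le> rearr_osc M u t"
      unfolding rearr_osc_def max_rearr_def using r0[of t] True by (simp add: divide_right_mono_ennreal)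
    moreover have "ennreal (W / (2 * V)) \<le> ennreal W / ennreal t"
      using True V W by (simp add: divide_ennreal divide_left_mono)
    moreover have "(2 * V) powr (- \<alpha> / Q) \<le> t powr (- \<alpha> / Q)"
      using True V \<alpha> Q by (intro powr_mono2') (auto simp: divide_nonpos_pos)
    ultimately have "ennreal ((2 * V) powr (- \<alpha> / Q)) * ennreal (W / (2 * V)) \<le>
        ennreal (t powr (- \<alpha> / Q)) * rearr_osc M u t"
      by (intro mult_mono ennreal_leI) auto
    moreover have "ennreal k = ennreal ((2 * V) powr (- \<alpha> / Q)) * ennreal (W / (2 * V))"
      unfolding k_def using V W by (intro ennreal_mult) auto
    ultimately show ?thesis using True by simp
  qed simp
  have "ennreal k * Nbar (indicator {0<..<V}) = Nbar (\<lambda>t. k * indicator {V<..<2 * V} t)"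
    using k by (subst Xbar.norm_scale) (auto intro!: borel_imp_half_line simp: ind(1))
  also have "\<dots> = enorm half_line Nbar (\<lambda>t. ennreal (k * indicator {V<..<2 * V} t))"
    using k by (simp add: enorm_def)
  also have "\<dots> \<le> enorm half_line Nbar (\<lambda>t. ennreal (t powr (- \<alpha> / Q)) * rearr_osc M u t)"
    using low by (intro enorm_mono[OF Xbar.ri_space_axioms] borel_imp_half_line AE_I2) auto
  also have "\<dots> \<le> ennreal C * (ennreal (\<delta> powr (- \<alpha>)) * Nbar (indicator {0<..<V}))"
    using main semi Ng by (meson mult_left_mono order_trans zero_le)
  also have "\<dots> = ennreal (C * \<delta> powr (- \<alpha>)) * Nbar (indicator {0<..<V})"
    using C by (simp add: ennreal_mult mult.assoc)
  finally have le: "ennreal k * Nbar (indicator {0<..<V}) \<le> \<dots>" .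
  obtain n where n: "Nbar (indicator {0<..<V}) = ennreal n" "0 < n"
    using ind(2,3) by (cases "Nbar (indicator {0<..<V})") auto
  have "ennreal (k * n) \<le> ennreal (C * \<delta> powr (- \<alpha>) * n)"
    using le n k C by (simp add: ennreal_mult)
  then have "k * n \<le> C * \<delta> powr (- \<alpha>) * n" using C n by (simp add: ennreal_le_iff)
  then have "k \<le> C * \<delta> powr (- \<alpha>)" using n(2) by simp
  then show ?thesis unfolding k_def V_def W_def \<delta>_def .
qed

text \<open>Passing from radius \<open>s\<close> to \<open>s - 2 * K * V s powr (1 / Q)\<close> at least halves \<open>V\<close>, so the
  successive decrements of the radius are dominated by a geometric series.\<close>

lemma growth_of_doubling_gap:
  fixes V :: "real \<Rightarrow> real"
  assumes Q: "0 < Q" and K: "0 < K" and mono: "\<And>r s. 0 < r \<Longrightarrow> r \<le> s \<Longrightarrow> V r \<le> V s"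
    and pos: "\<And>r. 0 < r \<Longrightarrow> 0 < V r"
    and gap: "\<And>\<rho> r. 0 < \<rho> \<Longrightarrow> \<rho> < r \<Longrightarrow> V r / 2 \<le> V \<rho> \<Longrightarrow> r - \<rho> \<le> K * V r powr (1 / Q)"
    and r: "0 < r"
  shows "((1 - (1 / 2) powr (1 / Q)) / (2 * K)) powr Q * r powr Q \<le> V r"
proof -
  \<comment> \<open>The ratio of the geometric series: halving \<open>V\<close> multiplies
    \<open>V powr (1 / Q)\<close> by \<open>q\<close>.\<close>
  define q :: real where "q = (1 / 2) powr (1 / Q)"
  have q: "0 < q" "q < 1" using Q powr_less_mono2[of "1 / Q" "1 / 2" 1] by (auto simp: q_def)
  \<comment> \<open>Here \<open>k\<close> bounds the number of halvings after which monotonicity of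
    \<open>V\<close> forces the radius down to at most \<open>\<epsilon>\<close>.\<close>
  have claim: "s \<le> \<epsilon> + 2 * K * (\<Sum>j<k. q ^ j) * V s powr (1 / Q)"
    if "0 < s" "0 < \<epsilon>" "V s < 2 ^ k * V \<epsilon>" for k s \<epsilon>
    using that
  proof (induction k arbitrary: s)
    case 0
    then show ?case using mono[of \<epsilon> s] by (cases "s \<le> \<epsilon>") auto
  next
    case (Suc k)
    \<comment> \<open>\<open>D\<close> is twice the largest gap permitted by \<open>gap\<close>, so
      after stepping down by \<open>D\<close> less than half of \<open>V s\<close> can
      remain.\<close>
    define D where "D = 2 * K * V s powr (1 / Q)"
    have D: "0 < D" using K pos[OF Suc.prems(1)] by (simp add: D_def)
    have S: "(\<Sum>j<Suc k. q ^ j) = 1 + q * (\<Sum>j<k. q ^ j)"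
      by (subst sum.lessThan_Suc_shift) (simp add: sum_distrib_left)
    have S0: "0 \<le> (\<Sum>j<k. q ^ j)" using q by (intro sum_nonneg) auto
    have goal: "\<epsilon> + 2 * K * (\<Sum>j<Suc k. q ^ j) * V s powr (1 / Q) = \<epsilon> + D + D * q * (\<Sum>j<k. q ^ j)"
      unfolding S D_def by (simp add: algebra_simps)
    show ?case
    proof (cases "s \<le> D")
      case True
      have "0 \<le> D * q * (\<Sum>j<k. q ^ j)" using D q S0 by simp
      then show ?thesis unfolding goal using True Suc.prems(2) by linarith
    next
      case False
      define \<rho> where "\<rho> = s - D"
      have \<rho>: "0 < \<rho>" "\<rho> < s" using False D by (auto simp: \<rho>_def)
      have half: "V \<rho> < V s / 2"
      proof (rule ccontr)
        assume "\<not> ?thesis"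
        then have "D \<le> K * V s powr (1 / Q)" using gap[OF \<rho>] by (simp add: \<rho>_def)
        then show False using D by (simp add: D_def)
      qed
      have "V \<rho> < 2 ^ k * V \<epsilon>" using half Suc.prems(3) by simp
      from Suc.IH[OF \<rho>(1) Suc.prems(2) this]
      have "\<rho> \<le> \<epsilon> + 2 * K * (\<Sum>j<k. q ^ j) * V \<rho> powr (1 / Q)" .
      also have "V \<rho> powr (1 / Q) \<le> (1 / 2 * V s) powr (1 / Q)"
        using half Q pos[OF \<rho>(1)] by (intro powr_mono2) auto
      also have "\<dots> = q * V s powr (1 / Q)"
        using pos[OF Suc.prems(1)] by (subst powr_mult) (auto simp: q_def)
      finally have "\<rho> \<le> \<epsilon> + 2 * K * (\<Sum>j<k. q ^ j) * (q * V s powr (1 / Q))"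
        using K S0 by (simp add: mult_left_mono)
      also have "\<dots> = \<epsilon> + D * q * (\<Sum>j<k. q ^ j)" by (simp add: D_def algebra_simps)
      finally show ?thesis unfolding goal by (simp add: \<rho>_def)
    qed
  qed
  define L where "L = 2 * K / (1 - q)"
  have L: "0 < L" using K q by (simp add: L_def)
  have bound: "s \<le> L * V s powr (1 / Q)" if s: "0 < s" for s
  proof (rule field_le_epsilon)
    fix \<epsilon> :: real assume \<epsilon>: "0 < \<epsilon>"
    \<comment> \<open>The number of halvings depends on \<open>\<epsilon>\<close>, but the full
      geometric series bounds every partial sum, so \<open>\<epsilon>\<close> can then tend to
      zero.\<close>
    obtain k where "V s / V \<epsilon> < 2 ^ k" using real_arch_pow[of 2] by auto
    then have "V s < 2 ^ k * V \<epsilon>" using pos[OF \<epsilon>] by (simp add: field_simps)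
    note claim[OF s \<epsilon> this]
    also have "(\<Sum>j<k. q ^ j) \<le> 1 / (1 - q)"
    proof -
      have "(\<Sum>j<k. q ^ j) \<le> (\<Sum>j. q ^ j)" using q by (intro sum_le_suminf summable_geometric) auto
      then show ?thesis using q by (simp add: suminf_geometric)
    qed
    finally have "s \<le> \<epsilon> + 2 * K * (1 / (1 - q)) * V s powr (1 / Q)"
      using K by (simp add: mult_left_mono mult_right_mono)
    then show "s \<le> L * V s powr (1 / Q) + \<epsilon>" by (simp add: L_def)
  qed
  have "((1 - q) / (2 * K)) powr Q * r powr Q = (1 / L) powr Q * r powr Q" by (simp add: L_def)
  also have "\<dots> = (r / L) powr Q" using L r by (simp flip: powr_mult)
  also have "\<dots> \<le> (V r powr (1 / Q)) powr Q"
    using bound[OF r] L r Q by (intro powr_mono2) (auto simp: field_simps)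
  also have "\<dots> = V r" using Q pos[OF r] by (simp add: powr_powr)
  finally show ?thesis unfolding q_def .
qed

section \<open>The two implications\<close>

text \<open>Under the half measure condition a root of the growth inequality is the gap hypothesis
  of \<open>growth_of_doubling_gap\<close>. Its constant \<open>K\<close> is the same for all
  centres, so the resulting bound passes to the infimum.\<close>

lemma hajlasz_embedding_imp_measure_lower_bound:
  fixes M :: "'a::metric_space measure"
  assumes "metric_measure_space M" and Q: "0 < Q" and \<alpha>: "0 < \<alpha>" "\<alpha> \<le> 1"
    and "ri_space M N" and rep: "is_representation M N Nbar" and C: "0 < C"
    and ineq: "\<And>f. f \<in> hajlasz_space M N \<alpha> \<Longrightarrow>
      enorm half_line Nbar (\<lambda>t. ennreal (t powr (- \<alpha> / Q)) * rearr_osc M f t)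
        \<le> ennreal C * hajlasz_seminorm M N \<alpha> f"
  shows "\<exists>c>0. \<forall>r>0. ennreal (c * r powr Q) \<le> h_mu M r"
proof -
  interpret metric_measure_space M by fact
  have ball_sets: "ball y s \<in> sets M" for y :: 'a and s by (simp add: sets_eq_borel)
  have fin: "emeasure M (ball x r) = ennreal (measure M (ball x r))" for x r
    using ball_finite[of x r] by (intro emeasure_eq_ennreal_measure) auto
  have pos: "0 < measure M (ball x r)" if "0 < r" for x r
    using ball_pos[OF that, of x] fin[of x r] by simp
  \<comment> \<open>The 4 comes from the ratio of measures being at least \<open>1 / 4\<close>, the
    power of 2 from the argument \<open>2 * V\<close>; both appear after taking the root of order
    \<open>\<alpha>\<close>.\<close>
  define K where "K = (4 * C) powr (1 / \<alpha>) * 2 powr (1 / Q)"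
  have K: "0 < K" using C by (simp add: K_def)
  have gap: "r - \<rho> \<le> K * measure M (ball x r) powr (1 / Q)"
    if \<rho>: "0 < \<rho>" "\<rho> < r" and half: "measure M (ball x r) / 2 \<le> measure M (ball x \<rho>)" for \<rho> r x
  proof -
    define V where "V = measure M (ball x r)"
    have V: "0 < V" using pos[of r x] \<rho> by (simp add: V_def)
    define \<delta> where "\<delta> = r - \<rho>"
    have \<delta>: "0 < \<delta>" using \<rho> by (simp add: \<delta>_def)
    have "(2 * V) powr (- \<alpha> / Q) * (1 / 4) \<le>
        (2 * V) powr (- \<alpha> / Q) * (measure M (ball x \<rho>) / (2 * V))"
      using half V by (intro mult_left_mono) (auto simp: V_def field_simps)
    also have "\<dots> \<le> C * \<delta> powr (- \<alpha>)"
      unfolding V_def \<delta>_def by (rule ball_growth_inequality) fact+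
    finally have "\<delta> powr \<alpha> \<le> 4 * C * (2 * V) powr (\<alpha> / Q)"
      using V \<delta> C by (simp add: powr_minus field_simps)
    then have "(\<delta> powr \<alpha>) powr (1 / \<alpha>) \<le> (4 * C * (2 * V) powr (\<alpha> / Q)) powr (1 / \<alpha>)"
      using \<alpha> by (intro powr_mono2) auto
    also have "\<dots> = K * V powr (1 / Q)"
      using \<alpha> Q C V by (simp add: powr_mult powr_powr K_def)
    finally show ?thesis using \<delta> \<alpha> by (simp add: powr_powr V_def \<delta>_def)
  qed
  have mono: "measure M (ball x r) \<le> measure M (ball x s)" if "r \<le> s" for x r s
    using emeasure_mono[OF subset_ball[OF that] ball_sets, of x] by (auto simp: fin)
  define c where "c = ((1 - (1 / 2) powr (1 / Q)) / (2 * K)) powr Q"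
  have "(1 / 2) powr (1 / Q) < (1 :: real)" using Q powr_less_mono2[of "1 / Q" "1 / 2" 1] by simp
  then have "0 < c" using K Q by (simp add: c_def)
  moreover have "ennreal (c * r powr Q) \<le> h_mu M r" if "0 < r" for r
    unfolding h_mu_def
  proof (rule INF_greatest)
    fix x
    have "c * r powr Q \<le> measure M (ball x r)"
      unfolding c_def by (intro growth_of_doubling_gap[OF Q K]) (auto intro: mono pos gap that)
    then show "ennreal (c * r powr Q) \<le> emeasure M (ball x r)" unfolding fin by (rule ennreal_leI)
  qed
  ultimately show ?thesis by blast
qed

text \<open>The weight \<open>t powr (- \<alpha> / Q)\<close> exactly cancels the power of
  \<open>t\<close> in the oscillation bound. What remains is the average of the rearranged gradient,
  to which \<open>hardy_averaging\<close> applies before the infimum over gradients is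
  taken.\<close>

lemma measure_lower_bound_imp_hajlasz_embedding:
  fixes M :: "'a::metric_space measure"
  assumes "metric_measure_space M" and Q: "0 < Q" and \<alpha>: "0 < \<alpha>"
    and rep: "is_representation M N Nbar" and boyd: "upper_boyd_index Nbar < 1"
    and c: "0 < c" and lower: "\<And>r. 0 < r \<Longrightarrow> ennreal (c * r powr Q) \<le> h_mu M r"
  shows "\<exists>C>0. \<forall>f\<in>hajlasz_space M N \<alpha>.
      enorm half_line Nbar (\<lambda>t. ennreal (t powr (- \<alpha> / Q)) * rearr_osc M f t)
        \<le> ennreal C * hajlasz_seminorm M N \<alpha> f"
proof -
  interpret metric_measure_space M by fact
  interpret Xbar: half_line_ri_space Nbar
    using rep unfolding half_line_ri_space_def is_representation_def by blast
  have N: "N f = enorm half_line Nbar (rearr M f)" if "f \<in> borel_measurable M" for f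
    using rep that by (simp add: is_representation_def)
  have sp [simp]: "space M = UNIV" using sets_eq_imp_space_eq[OF sets_eq_borel] by simp
  have balls: "ennreal (c * r powr Q) \<le> emeasure M (ball x r)" if "0 < r" for x r
    using lower[OF that] unfolding h_mu_def by (rule order_trans) (auto intro: INF_lower)
  obtain H where H: "0 < H" and hardy: "\<And>R. antimono R \<Longrightarrow> enorm half_line Nbar R < \<infinity> \<Longrightarrow>
      enorm half_line Nbar (\<lambda>t. (\<integral>\<^sup>+x\<in>{0<..<t}. R x \<partial>lborel) / ennreal t)
        \<le> ennreal H * enorm half_line Nbar R"
    using Xbar.hardy_averaging[OF boyd] by blast
  define K where "K = 2 * (3 / c) powr (\<alpha> / Q)"
  have K: "0 < K" using c by (simp add: K_def)
  define C where "C = K * H"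
  have C: "0 < C" using K H by (simp add: C_def)
  have "enorm half_line Nbar (\<lambda>t. ennreal (t powr (- \<alpha> / Q)) * rearr_osc M f t)
        \<le> ennreal C * hajlasz_seminorm M N \<alpha> f" (is "?lhs \<le> _") if f: "f \<in> hajlasz_space M N \<alpha>" for f
  proof -
    have fm: "f \<in> borel_measurable M" and Nf: "N f < \<infinity>"
      using f by (auto simp: hajlasz_space_def space_of_def)
    have le: "?lhs \<le> ennreal C * N g" if g: "g \<in> hajlasz_gradients M \<alpha> f" for g
    \<comment> \<open>A gradient of infinite norm makes the bound trivial since
      \<open>0 < C\<close>; finite norm makes its rearrangement finite at every positive argument,
      as the pointwise estimate requires.\<close>
    proof (cases "N g < \<infinity>")
      case True
      have gm: "g \<in> borel_measurable M" using g by (simp add: hajlasz_gradients_def)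
      have pointwise: "ennreal (t powr (- \<alpha> / Q)) * rearr_osc M f t \<le> ennreal K * max_rearr M g t"
        if t: "0 < t" for t
      proof -
        have "rearr_osc M f t \<le> ennreal (2 * (3 * t / c) powr (\<alpha> / Q)) * max_rearr M g t"
          using assms(1) Q \<alpha> c balls fm g t
        proof (rule rearr_osc_le_max_rearr_gradient)
          show "rearr M f t < \<infinity>" using Nf t unfolding N[OF fm] by (rule rearr_finite)
          show "rearr M g s < \<infinity>" if "0 < s" for s
            using True that unfolding N[OF gm] by (rule rearr_finite)
        qed
        also have "2 * (3 * t / c) powr (\<alpha> / Q) = K * t powr (\<alpha> / Q)"
          using t c by (simp add: K_def powr_mult powr_divide)
        finally have "ennreal (t powr (- \<alpha> / Q)) * rearr_osc M f t \<le>
            ennreal (t powr (- \<alpha> / Q)) * (ennreal (K * t powr (\<alpha> / Q)) * max_rearr M g t)"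
          by (intro mult_left_mono) auto
        also have "\<dots> = ennreal (t powr (- \<alpha> / Q) * (K * t powr (\<alpha> / Q))) * max_rearr M g t"
          using K by (simp add: ennreal_mult mult.assoc)
        also have "t powr (- \<alpha> / Q) * (K * t powr (\<alpha> / Q)) = K"
          using t by (simp add: powr_minus)
        finally show ?thesis .
      qed
      have "?lhs \<le> enorm half_line Nbar (\<lambda>t. ennreal K * max_rearr M g t)"
        using pointwise by (intro enorm_mono[OF Xbar.ri_space_axioms] borel_imp_half_line AE_I2) auto
      also have "\<dots> \<le> ennreal K * enorm half_line Nbar (max_rearr M g)"
        using K by (intro enorm_scale_le[OF Xbar.ri_space_axioms] borel_imp_half_line) auto
      also have "enorm half_line Nbar (max_rearr M g) \<le> ennreal H * N g"
        using hardy[of "rearr M g"] True unfolding N[OF gm] max_rearr_def[abs_def]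
        by (auto simp: antimono_def rearr_antimono)
      finally show ?thesis
        using K H by (simp add: C_def ennreal_mult mult.assoc mult_left_mono)
    qed (use C in \<open>simp add: ennreal_mult_top less_top[symmetric]\<close>)
    \<comment> \<open>With \<open>C\<close> moved to the left, the left side is a lower bound for
      all gradient norms and hence for their infimum; \<open>C\<close> is restored
      afterwards.\<close>
    have "ennreal (1 / C) * ?lhs \<le> hajlasz_seminorm M N \<alpha> f"
      unfolding hajlasz_seminorm_def
    proof (rule INF_greatest)
      fix g assume "g \<in> hajlasz_gradients M \<alpha> f"
      then have "ennreal (1 / C) * ?lhs \<le> ennreal (1 / C) * (ennreal C * N g)"
        by (intro mult_left_mono le) auto
      also have "\<dots> = N g" using C by (simp flip: mult.assoc ennreal_mult)
      finally show "ennreal (1 / C) * ?lhs \<le> N g" .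
    qed
    then have "ennreal C * (ennreal (1 / C) * ?lhs) \<le> ennreal C * hajlasz_seminorm M N \<alpha> f"
      by (intro mult_left_mono) auto
    also have "ennreal C * (ennreal (1 / C) * ?lhs) = ?lhs"
      using C by (simp flip: mult.assoc ennreal_mult)
    finally show ?thesis .
  qed
  with C show ?thesis by blast
qed

theorem theorem8:
  fixes M :: "'a::metric_space measure"
    and N :: "('a \<Rightarrow> real) \<Rightarrow> ennreal"
    and Nbar :: "(real \<Rightarrow> real) \<Rightarrow> ennreal"
    and Q \<alpha> :: real
  assumes "metric_measure_space M"
    and "0 < Q" and "0 < \<alpha>" and "\<alpha> \<le> 1"
    and "ri_space M N"
    and "is_representation M N Nbar"
    and "upper_boyd_index Nbar < 1"
  shows "(\<exists>C::real. 0 < C \<and> (\<forall>f\<in>hajlasz_space M N \<alpha>.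
            enorm half_line Nbar (\<lambda>t. ennreal (t powr (- \<alpha> / Q)) * rearr_osc M f t)
              \<le> ennreal C * hajlasz_seminorm M N \<alpha> f))
     \<longleftrightarrow> (\<exists>c::real. 0 < c \<and> (\<forall>r>0. ennreal (c * r powr Q) \<le> h_mu M r))"
proof
  assume "\<exists>C::real. 0 < C \<and> (\<forall>f\<in>hajlasz_space M N \<alpha>.
            enorm half_line Nbar (\<lambda>t. ennreal (t powr (- \<alpha> / Q)) * rearr_osc M f t)
              \<le> ennreal C * hajlasz_seminorm M N \<alpha> f)"
  then show "\<exists>c::real. 0 < c \<and> (\<forall>r>0. ennreal (c * r powr Q) \<le> h_mu M r)"
    using hajlasz_embedding_imp_measure_lower_bound[OF assms(1-6)] by blast
next
  assume "\<exists>c::real. 0 < c \<and> (\<forall>r>0. ennreal (c * r powr Q) \<le> h_mu M r)"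
  then show "\<exists>C::real. 0 < C \<and> (\<forall>f\<in>hajlasz_space M N \<alpha>.
            enorm half_line Nbar (\<lambda>t. ennreal (t powr (- \<alpha> / Q)) * rearr_osc M f t)
              \<le> ennreal C * hajlasz_seminorm M N \<alpha> f)"
    using measure_lower_bound_imp_hajlasz_embedding[OF assms(1-3,6,7)] by blast
qed

end
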